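(* Let $(M,F)$ be an $n$-dimensional Finsler space with dual Cartan structure $K$. Let $L_V$ be a leaf of the vertical foliation $V$ of $\mathcal{T}M$ (with $y\ne0$, $p\neq0$), lying over the point $a\in M$, let $L_{V_{\mathcal{E}}}$ be a leaf of the vertical Liouville foliation $V_{\mathcal{E}}$ that lies in $L_V$, and let $\gamma$ be an integral curve of $\frac{\mathcal{E}}{\sqrt{F^2+K^2}}$ (in $L_V$). Let $\nabla$ be the Levi-Civita connection of the Riemannian metric $G_{L_V}=G|_{L_V}$ on $L_V$. Then the following assertions are valid: i) $\gamma$ is a geodesic of $L_V$ with respect to $\nabla$. ii) $L_{V_{\mathcal{E}}}$ is totally umbilically immersed in $L_V$. iii) $L_{V_{\mathcal{E}}}$ lies in the generalized indicatrix $I_a=\{(y,p)\in T_aM^0\oplus T_a^*M^0 : F^2(a,y)+K^2(a,p)=1\}$ and has constant mean curvature equal to $-1$.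
   Context: Let $M$ be a smooth $n$-dimensional manifold, $TM^0$ and $T^*M^0$ its tangent and cotangent bundles with the zero sections removed ($T_aM^0$, $T_a^*M^0$ their fibres at $a$). A Finsler structure on $M$ is a function $F:TM\to[0,\infty)$, smooth on $TM^0$, with $F(x,\lambda y)=\lambda F(x,y)$ for $\lambda>0$, and such that $g_{ij}(x,y)=\frac12\frac{\partial^2F^2}{\partial y^i\partial y^j}$ is positive definite on $TM^0$; $(M,F)$ is called a Finsler space. The dual Cartan structure $K:T^*M\to[0,\infty)$ is obtained from $F$ by Legendre transformation: $K(x,p)=F(x,y)$ whenever $p_i=g_{ij}(x,y)y^j$, $y\ne0$, and $K(x,0)=0$. It is smooth on $T^*M^0$, satisfies $K(x,\lambda p)=\lambda K(x,p)$ for $\lambda>0$, and $g^{*ij}(x,p)=\frac12\frac{\partial^2K^2}{\partial p_i\partial p_j}$ is positive definite on $T^*M^0$. The big-tangent manifold $\mathcal{T}M$ is the total space of $TM\oplus T^*M\to M$, a $3n$-dimensional manifold with local coordinates $(x^i,y^i,p_i)$, where $(x^i)$ are coordinates on $M$, $(y^i)$ vector coordinates and $(p_i)$ covector coordinates; we work on its open subset where $y\ne 0$ and $p\neq 0$. The vertical bundle $V$ (the kernel of the differential of the projection to $M$) has local frame $\{\frac{\partial}{\partial y^i},\frac{\partial}{\partial p_i}\}$. The metric $G$ on $V$ is $G(X,Y)=g_{ij}(x,y)X_1^iY_1^j+g^{*ij}(x,p)X^2_iY^2_j$ for $X=X_1^i\frac{\partial}{\partial y^i}+X^2_i\frac{\partial}{\partial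 p_i}$, $Y=Y_1^j\frac{\partial}{\partial y^j}+Y^2_j\frac{\partial}{\partial p_j}$ in $\Gamma(V)$. The Liouville vector field is $\mathcal{E}=y^i\frac{\partial}{\partial y^i}+p_i\frac{\partial}{\partial p_i}$, and $G(\mathcal E,\mathcal E)=F^2+K^2$. The vertical Liouville distribution $V_{\mathcal{E}}$ is the $G$-orthogonal complement of the line distribution spanned by $\mathcal{E}$ in $V$; it is integrable. A leaf $L_V$ of $V$ is given locally by $x^i=a^i$ constant, so its tangent bundle is $V|_{L_V}$. The leaf $L_{V_{\mathcal{E}}}$ is a hypersurface of $L_V$ with unit normal $\frac{\mathcal{E}}{\sqrt{F^2+K^2}}$; its second fundamental form is $B(X,Y)=\frac{1}{\sqrt{F^2+K^2}}G_{L_V}(\nabla_XY,\mathcal{E})$ for $X,Y\in\Gamma(TL_{V_{\mathcal{E}}})$. It is totally umbilical if $B=\lambda\,G_{L_V}$ on $TL_{V_{\mathcal{E}}}$ for some function $\lambda$, and its mean curvature is $\frac{1}{2n-1}\sum_{i=1}^{2n-1}B(E_i,E_i)$ for an orthonormal frame $\{E_i\}$ of $TL_{V_{\mathcal{E}}}$.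
   Formalization: Assertion iii) fails for leaves outside I_a (e.g. a sphere of radius 2 when F=|y|, K=|p|); it is proved for leaves that meet I_a, and in general each leaf lies in some level F²+K²=r², r>0, with constant mean curvature −1/r. *)

theory Defs
  imports "HOL-Analysis.Analysis"
begin

subsection \<open>Smooth maps and smooth manifolds\<close>

text \<open>\<open>Ck_on k f S\<close> is meant for open \<open>S\<close>: all iterated directional derivatives of \<open>f\<close>
  of order at most \<open>k\<close> exist and are continuous on \<open>S\<close>.\<close>

primrec Ck_on ::
    "nat \<Rightarrow> ('a::real_normed_vector \<Rightarrow> 'b::real_normed_vector) \<Rightarrow> 'a set \<Rightarrow> bool" where
  "Ck_on 0 f S \<longleftrightarrow> continuous_on S f"
| "Ck_on (Suc k) f S \<longleftrightarrow>
     (\<forall>x\<in>S. f differentiable (at x)) \<and> (\<forall>v. Ck_on k (\<lambda>x. frechet_derivative f (at x) v) S)"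

definition smooth_on :: "'a::real_normed_vector set \<Rightarrow> ('a \<Rightarrow> 'b::real_normed_vector) \<Rightarrow> bool" where
  "smooth_on S f \<longleftrightarrow> (\<forall>k. Ck_on k f S)"

text \<open>A chart is a pair \<open>(U, \<phi>)\<close>; the values of \<open>\<phi>\<close> outside \<open>U\<close> are irrelevant.
  The dimension of the manifold is \<open>CARD('n)\<close>.\<close>

type_synonym ('m, 'n) chart = "'m set \<times> ('m \<Rightarrow> real ^ 'n)"

abbreviation cdom :: "('m, 'n) chart \<Rightarrow> 'm set" where "cdom \<equiv> fst"
abbreviation cmap :: "('m, 'n) chart \<Rightarrow> 'm \<Rightarrow> real ^ 'n" where "cmap \<equiv> snd"

definition cinv :: "('m, 'n) chart \<Rightarrow> real ^ 'n \<Rightarrow> 'm" where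
  "cinv c = inv_into (cdom c) (cmap c)"

definition smooth_manifold :: "'m topology \<Rightarrow> ('m, 'n::finite) chart set \<Rightarrow> bool" where
  "smooth_manifold X A \<longleftrightarrow>
     Hausdorff_space X \<and> second_countable X \<and> \<Union>(cdom ` A) = topspace X \<and>
     (\<forall>c\<in>A. openin X (cdom c) \<and> open (cmap c ` cdom c) \<and>
        homeomorphic_map (subtopology X (cdom c)) (top_of_set (cmap c ` cdom c)) (cmap c)) \<and>
     (\<forall>c\<in>A. \<forall>d\<in>A. smooth_on (cmap c ` (cdom c \<inter> cdom d)) (cmap d \<circ> cinv c))"


subsection \<open>Tangent, cotangent and big-tangent manifold\<close>

text \<open>The matrix \<open>\<partial>x'\<^sup>i/\<partial>x\<^sup>j\<close> at \<open>a\<close> of the change from the coordinates \<open>x\<close> of \<open>c\<close> to the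
  coordinates \<open>x'\<close> of \<open>d\<close>.\<close>

definition trans_jac ::
    "('m, 'n::finite) chart \<Rightarrow> ('m, 'n) chart \<Rightarrow> 'm \<Rightarrow> real ^ 'n ^ 'n" where
  "trans_jac c d a = jacobian (cmap d \<circ> cinv c) (at (cmap c a))"

text \<open>A tangent or cotangent vector at \<open>a\<close> is the family of its component vectors with respect
  to all charts around \<open>a\<close>, subject to the contravariant law \<open>y'\<^sup>i = (\<partial>x'\<^sup>i/\<partial>x\<^sup>j) y\<^sup>j\<close> or to the
  covariant law \<open>p\<^sub>j = (\<partial>x'\<^sup>i/\<partial>x\<^sup>j) p'\<^sub>i\<close>. Its entries at all other arguments are \<open>0\<close>, so
  that equality of functions is equality of (co)tangent vectors and \<open>\<lambda>_. 0\<close> is the zero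
  (co)vector.\<close>

type_synonym ('m, 'n) components = "('m, 'n) chart \<Rightarrow> real ^ 'n"

definition tangent_space ::
    "('m, 'n::finite) chart set \<Rightarrow> 'm \<Rightarrow> ('m, 'n) components set" where
  "tangent_space A a =
     {v. (\<forall>c. \<not> (c \<in> A \<and> a \<in> cdom c) \<longrightarrow> v c = 0) \<and>
         (\<forall>c\<in>A. \<forall>d\<in>A. a \<in> cdom c \<inter> cdom d \<longrightarrow> v d = trans_jac c d a *v v c)}"

definition cotangent_space ::
    "('m, 'n::finite) chart set \<Rightarrow> 'm \<Rightarrow> ('m, 'n) components set" where
  "cotangent_space A a =
     {p. (\<forall>c. \<not> (c \<in> A \<and> a \<in> cdom c) \<longrightarrow> p c = 0) \<and>
         (\<forall>c\<in>A. \<forall>d\<in>A. a \<in> cdom c \<inter> cdom d \<longrightarrow> p c = transpose (trans_jac c d a) *v p d)}"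

text \<open>The tangent vector (covector) at \<open>a\<close> whose components with respect to \<open>c\<close> are \<open>y\<close> (\<open>q\<close>).\<close>

definition tvec ::
    "('m, 'n::finite) chart set \<Rightarrow> ('m, 'n) chart \<Rightarrow> 'm \<Rightarrow> real ^ 'n \<Rightarrow> ('m, 'n) components" where
  "tvec A c a y = (\<lambda>d. if d \<in> A \<and> a \<in> cdom d then trans_jac c d a *v y else 0)"

definition tcovec ::
    "('m, 'n::finite) chart set \<Rightarrow> ('m, 'n) chart \<Rightarrow> 'm \<Rightarrow> real ^ 'n \<Rightarrow> ('m, 'n) components" where
  "tcovec A c a q = (\<lambda>d. if d \<in> A \<and> a \<in> cdom d then transpose (trans_jac d c a) *v q else 0)"

type_synonym ('m, 'n) big_tangent = "'m \<times> ('m, 'n) components \<times> ('m, 'n) components"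

text \<open>The open subset \<open>y \<noteq> 0\<close>, \<open>p \<noteq> 0\<close> of the big-tangent manifold.\<close>

definition big_tangent0 :: "('m, 'n::finite) chart set \<Rightarrow> ('m, 'n) big_tangent set" where
  "big_tangent0 A =
     {(a, v, p). a \<in> \<Union>(cdom ` A) \<and> v \<in> tangent_space A a \<and> p \<in> cotangent_space A a \<and>
        v \<noteq> (\<lambda>_. 0) \<and> p \<noteq> (\<lambda>_. 0)}"

type_synonym 'n fibre = "(real ^ 'n) \<times> (real ^ 'n)"
type_synonym 'n fibre_field = "'n fibre \<Rightarrow> 'n fibre"
type_synonym 'n fibre_metric = "'n fibre \<Rightarrow> 'n fibre \<Rightarrow> 'n fibre \<Rightarrow> real"

definition bt_coords ::
    "('m, 'n) chart \<Rightarrow> ('m, 'n) big_tangent \<Rightarrow> (real ^ 'n) \<times> (real ^ 'n) \<times> (real ^ 'n)" where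
  "bt_coords c = (\<lambda>(a, v, p). (cmap c a, v c, p c))"

definition fibre_coords ::
    "('m, 'n) chart \<Rightarrow> ('m, 'n) big_tangent \<Rightarrow> 'n fibre" where
  "fibre_coords c = (\<lambda>(a, v, p). (v c, p c))"


subsection \<open>Finsler and Cartan structures\<close>

text \<open>The matrix of the \<open>\<onehalf> \<partial>\<^sup>2f/\<partial>z\<^sup>i\<partial>z\<^sup>j\<close>.\<close>

definition half_hessian :: "(real ^ 'n \<Rightarrow> real) \<Rightarrow> real ^ 'n::finite \<Rightarrow> real ^ 'n ^ 'n" where
  "half_hessian f y =
     (\<chi> i j. (1/2) *
        frechet_derivative (\<lambda>z. frechet_derivative f (at z) (axis j 1)) (at y) (axis i 1))"

definition finsler_g ::
    "('m, 'n::finite) chart set \<Rightarrow> ('m \<Rightarrow> ('m, 'n) components \<Rightarrow> real) \<Rightarrow>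
     ('m, 'n) chart \<Rightarrow> 'm \<Rightarrow> real ^ 'n \<Rightarrow> real ^ 'n ^ 'n" where
  "finsler_g A F c a = half_hessian (\<lambda>y. (F a (tvec A c a y))\<^sup>2)"

definition cartan_g ::
    "('m, 'n::finite) chart set \<Rightarrow> ('m \<Rightarrow> ('m, 'n) components \<Rightarrow> real) \<Rightarrow>
     ('m, 'n) chart \<Rightarrow> 'm \<Rightarrow> real ^ 'n \<Rightarrow> real ^ 'n ^ 'n" where
  "cartan_g A K c a = half_hessian (\<lambda>q. (K a (tcovec A c a q))\<^sup>2)"

definition finsler_structure ::
    "('m, 'n::finite) chart set \<Rightarrow> ('m \<Rightarrow> ('m, 'n) components \<Rightarrow> real) \<Rightarrow> bool" where
  "finsler_structure A F \<longleftrightarrow>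
     (\<forall>a\<in>\<Union>(cdom ` A). \<forall>v\<in>tangent_space A a.
        0 \<le> F a v \<and> (\<forall>r>0. F a (\<lambda>d. r *\<^sub>R v d) = r * F a v)) \<and>
     (\<forall>c\<in>A. smooth_on (cmap c ` cdom c \<times> (- {0}))
        (\<lambda>(x, y). F (cinv c x) (tvec A c (cinv c x) y))) \<and>
     (\<forall>c\<in>A. \<forall>a\<in>cdom c. \<forall>y. y \<noteq> 0 \<longrightarrow>
        (\<forall>w. w \<noteq> 0 \<longrightarrow> 0 < w \<bullet> (finsler_g A F c a y *v w)))"

definition cartan_structure ::
    "('m, 'n::finite) chart set \<Rightarrow> ('m \<Rightarrow> ('m, 'n) components \<Rightarrow> real) \<Rightarrow> bool" where
  "cartan_structure A K \<longleftrightarrow>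
     (\<forall>a\<in>\<Union>(cdom ` A). \<forall>p\<in>cotangent_space A a.
        0 \<le> K a p \<and> (\<forall>r>0. K a (\<lambda>d. r *\<^sub>R p d) = r * K a p)) \<and>
     (\<forall>c\<in>A. smooth_on (cmap c ` cdom c \<times> (- {0}))
        (\<lambda>(x, q). K (cinv c x) (tcovec A c (cinv c x) q))) \<and>
     (\<forall>c\<in>A. \<forall>a\<in>cdom c. \<forall>q. q \<noteq> 0 \<longrightarrow>
        (\<forall>w. w \<noteq> 0 \<longrightarrow> 0 < w \<bullet> (cartan_g A K c a q *v w)))"

text \<open>The last two conditions (Legendre transformation) determine \<open>K\<close> on the cotangent bundle.\<close>

definition dual_cartan_structure ::
    "('m, 'n::finite) chart set \<Rightarrow> ('m \<Rightarrow> ('m, 'n) components \<Rightarrow> real) \<Rightarrow>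
     ('m \<Rightarrow> ('m, 'n) components \<Rightarrow> real) \<Rightarrow> bool" where
  "dual_cartan_structure A F K \<longleftrightarrow>
     cartan_structure A K \<and>
     (\<forall>c\<in>A. \<forall>a\<in>cdom c. \<forall>v\<in>tangent_space A a. \<forall>p\<in>cotangent_space A a.
        v \<noteq> (\<lambda>_. 0) \<and> p c = finsler_g A F c a (v c) *v v c \<longrightarrow> K a p = F a v) \<and>
     (\<forall>a\<in>\<Union>(cdom ` A). K a (\<lambda>_. 0) = 0)"


subsection \<open>The vertical and the vertical Liouville foliation\<close>

text \<open>The vertical bundle over the fibre at \<open>a\<close> in the coordinates of \<open>c\<close>: the pair \<open>(y, p)\<close> is
  the base point, and \<open>(X\<^sub>1, X\<^sub>2)\<close> stands for \<open>X\<^sub>1\<^sup>i \<partial>/\<partial>y\<^sup>i + X\<^sub>2\<^sub>i \<partial>/\<partial>p\<^sub>i\<close>.\<close>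

definition vertical_metric ::
    "('m, 'n::finite) chart set \<Rightarrow> ('m \<Rightarrow> ('m, 'n) components \<Rightarrow> real) \<Rightarrow>
     ('m \<Rightarrow> ('m, 'n) components \<Rightarrow> real) \<Rightarrow> ('m, 'n) chart \<Rightarrow> 'm \<Rightarrow>
     'n fibre_metric" where
  "vertical_metric A F K c a = (\<lambda>(y, p) (X\<^sub>1, X\<^sub>2) (Y\<^sub>1, Y\<^sub>2).
     X\<^sub>1 \<bullet> (finsler_g A F c a y *v Y\<^sub>1) + X\<^sub>2 \<bullet> (cartan_g A K c a p *v Y\<^sub>2))"

text \<open>The Liouville field \<open>y\<^sup>i \<partial>/\<partial>y\<^sup>i + p\<^sub>i \<partial>/\<partial>p\<^sub>i\<close>, in fibre coordinates.\<close>

definition liouville :: "'n fibre_field" where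
  "liouville = (\<lambda>(y, p). (y, p))"

text \<open>The function \<open>sqrt (F\<^sup>2 + K\<^sup>2)\<close> in fibre coordinates.\<close>

definition liouville_norm ::
    "('m, 'n::finite) chart set \<Rightarrow> ('m \<Rightarrow> ('m, 'n) components \<Rightarrow> real) \<Rightarrow>
     ('m \<Rightarrow> ('m, 'n) components \<Rightarrow> real) \<Rightarrow> ('m, 'n) chart \<Rightarrow> 'm \<Rightarrow>
     'n fibre \<Rightarrow> real" where
  "liouville_norm A F K c a =
     (\<lambda>(y, p). sqrt ((F a (tvec A c a y))\<^sup>2 + (K a (tcovec A c a p))\<^sup>2))"

text \<open>A distribution on the big-tangent manifold, in coordinates: \<open>D c u\<close> is the subspace at the
  point \<open>u\<close> with respect to the coordinates \<open>bt_coords c\<close>.\<close>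

type_synonym ('m, 'n) distribution =
  "('m, 'n) chart \<Rightarrow> ('m, 'n) big_tangent \<Rightarrow> ((real ^ 'n) \<times> (real ^ 'n) \<times> (real ^ 'n)) set"

definition vertical :: "('m, 'n::finite) distribution" where
  "vertical c u = {0} \<times> UNIV"

definition vertical_liouville ::
    "('m, 'n::finite) chart set \<Rightarrow> ('m \<Rightarrow> ('m, 'n) components \<Rightarrow> real) \<Rightarrow>
     ('m \<Rightarrow> ('m, 'n) components \<Rightarrow> real) \<Rightarrow> ('m, 'n) distribution" where
  "vertical_liouville A F K c u =
     {0} \<times> {Z. vertical_metric A F K c (fst u) (fibre_coords c u) Z
                 (liouville (fibre_coords c u)) = 0}"

text \<open>A \<open>C\<^sup>1\<close> curve on \<open>[0,1]\<close> in the big-tangent manifold all of whose velocities lie in \<open>D\<close>.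
  For a distribution \<open>D\<close> that transforms tensorially, as the two above do, it does not matter
  which chart is used locally.\<close>

definition tangent_curve ::
    "('m, 'n::finite) chart set \<Rightarrow> ('m, 'n) distribution \<Rightarrow> (real \<Rightarrow> ('m, 'n) big_tangent) \<Rightarrow> bool"
  where
  "tangent_curve A D \<gamma> \<longleftrightarrow>
     \<gamma> ` {0..1} \<subseteq> big_tangent0 A \<and>
     (\<forall>t\<in>{0..1}. \<exists>c\<in>A. \<exists>U. \<exists>\<gamma>'. open U \<and> t \<in> U \<and>
        continuous_on (U \<inter> {0..1}) \<gamma>' \<and>
        (\<forall>s\<in>U \<inter> {0..1}. fst (\<gamma> s) \<in> cdom c \<and>
           ((bt_coords c \<circ> \<gamma>) has_vector_derivative \<gamma>' s) (at s within {0..1}) \<and>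
           \<gamma>' s \<in> D c (\<gamma> s)))"

text \<open>The leaf of an integrable distribution through \<open>u\<close>: all points that can be joined to \<open>u\<close> by
  a piecewise \<open>C\<^sup>1\<close> curve tangent to the distribution.\<close>

definition leaf_through ::
    "('m, 'n::finite) chart set \<Rightarrow> ('m, 'n) distribution \<Rightarrow> ('m, 'n) big_tangent \<Rightarrow>
     ('m, 'n) big_tangent set" where
  "leaf_through A D u = {w. (u, w) \<in> {(\<gamma> 0, \<gamma> 1) | \<gamma>. tangent_curve A D \<gamma>}\<^sup>*}"

definition is_leaf ::
    "('m, 'n::finite) chart set \<Rightarrow> ('m, 'n) distribution \<Rightarrow> ('m, 'n) big_tangent set \<Rightarrow> bool" where
  "is_leaf A D L \<longleftrightarrow> (\<exists>u\<in>big_tangent0 A. L = leaf_through A D u)"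

definition generalized_indicatrix ::
    "('m, 'n::finite) chart set \<Rightarrow> ('m \<Rightarrow> ('m, 'n) components \<Rightarrow> real) \<Rightarrow>
     ('m \<Rightarrow> ('m, 'n) components \<Rightarrow> real) \<Rightarrow> 'm \<Rightarrow> ('m, 'n) big_tangent set" where
  "generalized_indicatrix A F K a =
     {(b, v, p) \<in> big_tangent0 A. b = a \<and> (F a v)\<^sup>2 + (K a p)\<^sup>2 = 1}"


subsection \<open>Levi-Civita connection and geodesics on an open subset of a vector space\<close>

text \<open>A connection maps a pair of vector fields to a vector field. Only smooth fields and only
  values at points of \<open>\<Omega>\<close> matter.\<close>

definition affine_connection ::
    "'a::euclidean_space set \<Rightarrow> (('a \<Rightarrow> 'a) \<Rightarrow> ('a \<Rightarrow> 'a) \<Rightarrow> 'a \<Rightarrow> 'a) \<Rightarrow> bool" where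
  "affine_connection \<Omega> nabla \<longleftrightarrow>
     (\<forall>X Y. smooth_on \<Omega> X \<and> smooth_on \<Omega> Y \<longrightarrow> smooth_on \<Omega> (nabla X Y)) \<and>
     (\<forall>f h X X' Y. smooth_on \<Omega> (f :: 'a \<Rightarrow> real) \<and> smooth_on \<Omega> (h :: 'a \<Rightarrow> real) \<and>
        smooth_on \<Omega> X \<and> smooth_on \<Omega> X' \<and> smooth_on \<Omega> Y \<longrightarrow>
        (\<forall>u\<in>\<Omega>. nabla (\<lambda>w. f w *\<^sub>R X w + h w *\<^sub>R X' w) Y u
                = f u *\<^sub>R nabla X Y u + h u *\<^sub>R nabla X' Y u)) \<and>
     (\<forall>X Y Y'. smooth_on \<Omega> X \<and> smooth_on \<Omega> Y \<and> smooth_on \<Omega> Y' \<longrightarrow>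
        (\<forall>u\<in>\<Omega>. nabla X (\<lambda>w. Y w + Y' w) u = nabla X Y u + nabla X Y' u)) \<and>
     (\<forall>f X Y. smooth_on \<Omega> (f :: 'a \<Rightarrow> real) \<and> smooth_on \<Omega> X \<and> smooth_on \<Omega> Y \<longrightarrow>
        (\<forall>u\<in>\<Omega>. nabla X (\<lambda>w. f w *\<^sub>R Y w) u
                = frechet_derivative f (at u) (X u) *\<^sub>R Y u + f u *\<^sub>R nabla X Y u))"

definition lie_bracket :: "('a::real_normed_vector \<Rightarrow> 'a) \<Rightarrow> ('a \<Rightarrow> 'a) \<Rightarrow> 'a \<Rightarrow> 'a" where
  "lie_bracket X Y u = frechet_derivative Y (at u) (X u) - frechet_derivative X (at u) (Y u)"

definition levi_civita ::
    "'a::euclidean_space set \<Rightarrow> ('a \<Rightarrow> 'a \<Rightarrow> 'a \<Rightarrow> real) \<Rightarrow>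
     (('a \<Rightarrow> 'a) \<Rightarrow> ('a \<Rightarrow> 'a) \<Rightarrow> 'a \<Rightarrow> 'a) \<Rightarrow> bool" where
  "levi_civita \<Omega> G nabla \<longleftrightarrow>
     affine_connection \<Omega> nabla \<and>
     (\<forall>X Y. smooth_on \<Omega> X \<and> smooth_on \<Omega> Y \<longrightarrow>
        (\<forall>u\<in>\<Omega>. nabla X Y u - nabla Y X u = lie_bracket X Y u)) \<and>
     (\<forall>X Y Z. smooth_on \<Omega> X \<and> smooth_on \<Omega> Y \<and> smooth_on \<Omega> Z \<longrightarrow>
        (\<forall>u\<in>\<Omega>. frechet_derivative (\<lambda>w. G w (Y w) (Z w)) (at u) (X u)
                = G u (nabla X Y u) (Z u) + G u (Y u) (nabla X Z u)))"

text \<open>The covariant derivative of a field \<open>V\<close> along a curve \<open>\<sigma>\<close>. The second summand is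
  \<open>\<Gamma>\<^sup>k\<^sub>i\<^sub>j \<sigma>'\<^sup>i V\<^sup>j\<close>: the Christoffel symbols are the covariant derivatives of constant fields.\<close>

definition covariant_derivative_along ::
    "(('a \<Rightarrow> 'a) \<Rightarrow> ('a \<Rightarrow> 'a) \<Rightarrow> 'a \<Rightarrow> 'a) \<Rightarrow> (real \<Rightarrow> 'a::euclidean_space) \<Rightarrow> (real \<Rightarrow> 'a) \<Rightarrow>
     real \<Rightarrow> 'a" where
  "covariant_derivative_along nabla \<sigma> V t =
     vector_derivative V (at t) + nabla (\<lambda>_. vector_derivative \<sigma> (at t)) (\<lambda>_. V t) (\<sigma> t)"

definition is_geodesic ::
    "(('a \<Rightarrow> 'a) \<Rightarrow> ('a \<Rightarrow> 'a) \<Rightarrow> 'a \<Rightarrow> 'a) \<Rightarrow> real set \<Rightarrow> (real \<Rightarrow> 'a::euclidean_space) \<Rightarrow> bool" where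
  "is_geodesic nabla I \<sigma> \<longleftrightarrow>
     (\<forall>t\<in>I. \<sigma> differentiable (at t) \<and>
        (\<lambda>s. vector_derivative \<sigma> (at s)) differentiable (at t) \<and>
        covariant_derivative_along nabla \<sigma> (\<lambda>s. vector_derivative \<sigma> (at s)) t = 0)"


subsection \<open>The second fundamental form of a leaf of the vertical Liouville foliation\<close>

text \<open>In this section \<open>\<Omega>\<close> and \<open>N \<subseteq> \<Omega>\<close> are the images in fibre coordinates of a leaf of the vertical
  foliation and of a leaf of the vertical Liouville foliation, \<open>G\<close> is the metric and \<open>\<rho>\<close> is
  \<open>sqrt (F\<^sup>2 + K\<^sup>2)\<close>. Sections of \<open>TN\<close> are given by smooth extensions to \<open>\<Omega>\<close>.\<close>

definition leaf_field ::
    "'n fibre set \<Rightarrow> 'n fibre set \<Rightarrow> 'n fibre_metric \<Rightarrow> ('n::finite) fibre_field \<Rightarrow> bool" where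
  "leaf_field \<Omega> N G X \<longleftrightarrow> smooth_on \<Omega> X \<and> (\<forall>u\<in>N. G u (X u) (liouville u) = 0)"

definition second_fundamental_form ::
    "('n::finite) fibre_metric \<Rightarrow> ('n fibre \<Rightarrow> real) \<Rightarrow>
     ('n fibre_field \<Rightarrow> 'n fibre_field \<Rightarrow> 'n fibre_field) \<Rightarrow>
     'n fibre_field \<Rightarrow> 'n fibre_field \<Rightarrow> 'n fibre \<Rightarrow> real" where
  "second_fundamental_form G \<rho> nabla X Y u = (1 / \<rho> u) * G u (nabla X Y u) (liouville u)"

definition totally_umbilical ::
    "'n fibre set \<Rightarrow> 'n fibre set \<Rightarrow> ('n::finite) fibre_metric \<Rightarrow> ('n fibre \<Rightarrow> real) \<Rightarrow>
     ('n fibre_field \<Rightarrow> 'n fibre_field \<Rightarrow> 'n fibre_field) \<Rightarrow> bool" where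
  "totally_umbilical \<Omega> N G \<rho> nabla \<longleftrightarrow>
     (\<exists>mu. \<forall>X Y. leaf_field \<Omega> N G X \<and> leaf_field \<Omega> N G Y \<longrightarrow>
        (\<forall>u\<in>N. second_fundamental_form G \<rho> nabla X Y u = mu u * G u (X u) (Y u)))"

text \<open>The second fundamental form is tensorial, so its trace at \<open>u\<close> only needs fields that are
  orthonormal at the point \<open>u\<close>.\<close>

definition orthonormal_leaf_fields ::
    "'n fibre set \<Rightarrow> 'n fibre set \<Rightarrow> ('n::finite) fibre_metric \<Rightarrow> 'n fibre \<Rightarrow>
     (nat \<Rightarrow> 'n fibre_field) \<Rightarrow> bool" where
  "orthonormal_leaf_fields \<Omega> N G u e \<longleftrightarrow>
     (\<forall>i\<in>{1..2 * CARD('n) - 1}. leaf_field \<Omega> N G (e i)) \<and>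
     (\<forall>i\<in>{1..2 * CARD('n) - 1}. \<forall>j\<in>{1..2 * CARD('n) - 1}.
        G u (e i u) (e j u) = (if i = j then 1 else 0))"

definition mean_curvature ::
    "'n fibre set \<Rightarrow> 'n fibre set \<Rightarrow> ('n::finite) fibre_metric \<Rightarrow> ('n fibre \<Rightarrow> real) \<Rightarrow>
     ('n fibre_field \<Rightarrow> 'n fibre_field \<Rightarrow> 'n fibre_field) \<Rightarrow> 'n fibre \<Rightarrow> real" where
  "mean_curvature \<Omega> N G \<rho> nabla u =
     (THE H. \<exists>e. orthonormal_leaf_fields \<Omega> N G u e \<and>
        H = (1 / (2 * real CARD('n) - 1)) *
            (\<Sum>i = 1..2 * CARD('n) - 1. second_fundamental_form G \<rho> nabla (e i) (e i) u))"

end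

theory Submission
  imports Defs
begin

text \<open>In the coordinates \<open>z = (y, p)\<close> of one fibre, \<open>g\<close> and
  \<open>g\<^sup>*\<close> are the halved Hessians of \<open>F\<^sup>2\<close> and
  \<open>K\<^sup>2\<close>, so \<open>G\<close> is the Hessian of the single potential
  \<open>\<Phi> = (F\<^sup>2 + K\<^sup>2) / 2\<close>, which is positively homogeneous of degree 2
  (lemma \<open>vertical_metric_hess\<close>). The theorem is a statement about the Hessian
  metrics of such potentials.

  Write \<open>E\<close> for the position field \<open>z \<mapsto> z\<close>, which is the
  Liouville field. Euler's theorem gives \<open>G\<^sub>z(z, v) = d\<Phi>\<^sub>z(v)\<close> and
  \<open>G(E, E) = 2 \<Phi> = \<rho>\<^sup>2\<close>, and \<open>G\<close> is constant along rays.
  Hence \<open>V\<^sub>E\<close>, the \<open>G\<close>-orthogonal complement of \<open>E\<close>,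
  is the kernel of \<open>d\<Phi>\<close>, and \<open>\<rho>\<close> has a constant value
  \<open>r\<close> on each of its leaves. The Koszul formula for a constant field
  \<open>X\<close>, the field \<open>E\<close> and a constant field \<open>Z\<close> collapses,
  because the derivatives \<open>X G(E, Z)\<close> and \<open>Z G(X, E)\<close> are both equal to
  \<open>D\<^sup>2\<Phi>(X, Z)\<close>, and leaves \<open>\<nabla>\<^sub>X E = X\<close> (lemmas
  \<open>nabla_const_position\<close>, \<open>nabla_position\<close>). The rest of the proof turns
  on this identity.

  For vector fields \<open>X\<close>, \<open>Y\<close> tangent to a leaf, differentiating
  \<open>G(Y, E) = 0\<close> along \<open>X\<close> gives \<open>G(\<nabla>\<^sub>X Y, E) = - G(Y,
  \<nabla>\<^sub>X E) = - G(Y, X)\<close>, that is \<open>B = - (1/r) G\<close>. The leaf is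
  totally umbilical and its mean curvature is \<open>- 1/r\<close>, which is \<open>- 1\<close>
  exactly on the indicatrix (lemmas \<open>second_fundamental_form_leaf\<close>,
  \<open>mean_curvature_leaf\<close>). The fields here are only known to be tangent on the leaf
  itself, so differentiating along \<open>X\<close> needs curves inside the leaf with given
  velocity; they are obtained by projecting a straight segment radially to the level set of
  \<open>\<Phi>\<close> (lemmas \<open>level_curve\<close>, \<open>derivative_along_leaf\<close>).

  For the integral curves of \<open>E / \<rho>\<close>, which are rays with constant velocity
  \<open>\<sigma> / \<rho>\<close>, the geodesic equation reduces to \<open>\<nabla>\<^sub>x x =
  0\<close> at \<open>z\<close> for the constant field with a value \<open>x\<close> parallel to
  \<open>z\<close> (lemmas \<open>nabla_radial_const\<close>, \<open>radial_geodesic\<close>).\<close>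

section \<open>Calculus of smooth functions\<close>

lemma Ck_on_SucD:
  "Ck_on (Suc k) f S \<Longrightarrow> Ck_on k f S"
proof (induction k arbitrary: f)
  case 0
  then have "f differentiable_on S"
    by (auto simp: differentiable_on_def intro: differentiable_at_withinI)
  then show ?case
    by (simp add: differentiable_imp_continuous_on)
next
  case (Suc k)
  have "Ck_on k (\<lambda>x. frechet_derivative f (at x) v) S" for v
    using Suc.prems by (intro Suc.IH) simp
  with Suc.prems show ?case
    by simp
qed

lemma Ck_on_cong:
  assumes "open S" and "\<And>x. x \<in> S \<Longrightarrow> f x = g x" and "Ck_on k f S"
  shows "Ck_on k g S"
  using assms(2,3)
proof (induction k arbitrary: f g)
  case 0
  then show ?case
    by (simp cong: continuous_on_cong)
next
  case (Suc k)
  have diff: "g differentiable (at x)" if "x \<in> S" for x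
    using Suc.prems that \<open>open S\<close> unfolding Ck_on.simps
    by (metis differentiable_def has_derivative_transform_within_open)
  have "frechet_derivative f (at x) = frechet_derivative g (at x)" if "x \<in> S" for x
    using Suc.prems that \<open>open S\<close>
    by (intro frechet_derivative_transform_within_open) auto
  with Suc diff show ?case
    by (auto intro: Suc.IH[of "\<lambda>x. frechet_derivative f (at x) v" for v])
qed

lemma Ck_on_const: "Ck_on k (\<lambda>_. b) S"
  by (induction k arbitrary: b) auto

lemma Ck_on_linear:
  assumes "bounded_linear f"
  shows "Ck_on k f S"
proof (cases k)
  case 0
  then show ?thesis
    using assms by (simp add: linear_continuous_on)
next
  case (Suc n)
  have "frechet_derivative f (at x) = f" for x
    using frechet_derivative_at[OF bounded_linear_imp_has_derivative[OF assms]] by simp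
  then show ?thesis
    using assms Suc by (simp add: bounded_linear_imp_differentiable Ck_on_const)
qed

lemma Ck_on_add:
  assumes "open S" "Ck_on k f S" "Ck_on k g S"
  shows "Ck_on k (\<lambda>x. f x + g x) S"
  using assms(2,3)
proof (induction k arbitrary: f g)
  case 0
  then show ?case
    by (simp add: continuous_on_add)
next
  case (Suc k)
  have der: "((\<lambda>x. f x + g x) has_derivative
      (\<lambda>v. frechet_derivative f (at x) v + frechet_derivative g (at x) v)) (at x)"
    if "x \<in> S" for x
    using Suc.prems that
    by (intro has_derivative_add) (simp_all flip: frechet_derivative_works)
  have "Ck_on k (\<lambda>x. frechet_derivative f (at x) v + frechet_derivative g (at x) v) S" for v
    using Suc.prems by (intro Suc.IH) auto
  then have "Ck_on k (\<lambda>x. frechet_derivative (\<lambda>x. f x + g x) (at x) v) S" for v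
    by (rule Ck_on_cong[OF \<open>open S\<close>, rotated]) (simp add: frechet_derivative_at[OF der, symmetric])
  with der show ?case
    by (auto simp: differentiable_def)
qed

lemma Ck_on_scaleR:
  fixes f :: "'a::real_normed_vector \<Rightarrow> real"
  assumes "open S" "Ck_on k f S" "Ck_on k g S"
  shows "Ck_on k (\<lambda>x. f x *\<^sub>R g x) S"
  using assms(2,3)
proof (induction k arbitrary: f g)
  case 0
  then show ?case
    by (simp add: continuous_on_scaleR)
next
  case (Suc k)
  have der: "((\<lambda>x. f x *\<^sub>R g x) has_derivative
      (\<lambda>v. f x *\<^sub>R frechet_derivative g (at x) v + frechet_derivative f (at x) v *\<^sub>R g x)) (at x)"
    if "x \<in> S" for x
    using Suc.prems that
    by (intro has_derivative_scaleR) (simp_all flip: frechet_derivative_works)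
  have "Ck_on k (\<lambda>x. f x *\<^sub>R frechet_derivative g (at x) v + frechet_derivative f (at x) v *\<^sub>R g x) S" for v
    using Suc.prems Suc.prems[THEN Ck_on_SucD] by (intro Ck_on_add \<open>open S\<close> Suc.IH) simp_all
  then have "Ck_on k (\<lambda>x. frechet_derivative (\<lambda>x. f x *\<^sub>R g x) (at x) v) S" for v
    by (rule Ck_on_cong[OF \<open>open S\<close>, rotated]) (simp add: frechet_derivative_at[OF der, symmetric])
  with der show ?case
    by (auto simp: differentiable_def)
qed

text \<open>Affine substitutions cover both the restriction of a function to a slice and the pullback
  of a function along a coordinate projection.\<close>

lemma Ck_on_affine:
  assumes "bounded_linear L" "open T" and sub: "\<And>x. x \<in> T \<Longrightarrow> b + L x \<in> S" and "Ck_on k f S"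
  shows "Ck_on k (\<lambda>x. f (b + L x)) T"
  using assms(4)
proof (induction k arbitrary: f)
  case 0
  have "continuous_on T (\<lambda>x. b + L x)"
    using assms(1) by (intro continuous_intros linear_continuous_on)
  with 0 sub show ?case
    by (auto intro: continuous_on_compose2)
next
  case (Suc k)
  have der: "((\<lambda>x. f (b + L x)) has_derivative (\<lambda>v. frechet_derivative f (at (b + L x)) (L v))) (at x)"
    if "x \<in> T" for x
  proof -
    have "((\<lambda>x. b + L x) has_derivative L) (at x)"
      using has_derivative_add[OF has_derivative_const bounded_linear_imp_has_derivative[OF assms(1)]]
      by simp
    moreover have "(f has_derivative frechet_derivative f (at (b + L x))) (at (b + L x))"
      using Suc.prems sub[OF that] by (simp flip: frechet_derivative_works)
    ultimately show ?thesis
      by (rule has_derivative_compose)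
  qed
  have "Ck_on k (\<lambda>x. frechet_derivative f (at (b + L x)) (L v)) T" for v
    using Suc.prems by (intro Suc.IH) simp
  then have "Ck_on k (\<lambda>x. frechet_derivative (\<lambda>x. f (b + L x)) (at x) v) T" for v
    by (rule Ck_on_cong[OF \<open>open T\<close>, rotated]) (simp add: frechet_derivative_at[OF der, symmetric])
  with der show ?case
    by (auto simp: differentiable_def)
qed

lemma smooth_on_cong:
  "open S \<Longrightarrow> (\<And>x. x \<in> S \<Longrightarrow> f x = g x) \<Longrightarrow> smooth_on S f \<Longrightarrow> smooth_on S g"
  unfolding smooth_on_def using Ck_on_cong by blast

lemma smooth_on_const: "smooth_on S (\<lambda>_. b)"
  by (simp add: smooth_on_def Ck_on_const)

lemma smooth_on_linear: "bounded_linear f \<Longrightarrow> smooth_on S f"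
  by (simp add: smooth_on_def Ck_on_linear)

lemma smooth_on_ident: "smooth_on S (\<lambda>x. x)"
  by (simp add: smooth_on_linear)

lemma smooth_on_add:
  "open S \<Longrightarrow> smooth_on S f \<Longrightarrow> smooth_on S g \<Longrightarrow> smooth_on S (\<lambda>x. f x + g x)"
  by (simp add: smooth_on_def Ck_on_add)

lemma smooth_on_scaleR:
  fixes f :: "'a::real_normed_vector \<Rightarrow> real"
  shows "open S \<Longrightarrow> smooth_on S f \<Longrightarrow> smooth_on S g \<Longrightarrow> smooth_on S (\<lambda>x. f x *\<^sub>R g x)"
  by (simp add: smooth_on_def Ck_on_scaleR)

lemma smooth_on_affine:
  "bounded_linear L \<Longrightarrow> open T \<Longrightarrow> (\<And>x. x \<in> T \<Longrightarrow> b + L x \<in> S) \<Longrightarrow> smooth_on S f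
    \<Longrightarrow> smooth_on T (\<lambda>x. f (b + L x))"
  unfolding smooth_on_def using Ck_on_affine by blast

lemma smooth_on_subset:
  assumes "smooth_on S f" "T \<subseteq> S"
  shows "smooth_on T f"
proof -
  have "Ck_on k f T" if "Ck_on k f S" for k
    using that
    by (induction k arbitrary: f) (use \<open>T \<subseteq> S\<close> in \<open>auto intro: continuous_on_subset\<close>)
  with assms(1) show ?thesis
    by (simp add: smooth_on_def)
qed

lemma smooth_on_inner_const:
  assumes "open S" "smooth_on S X"
  shows "smooth_on S (\<lambda>x. X x \<bullet> (b::'b::real_inner))"
proof -
  have "Ck_on k (\<lambda>x. X x \<bullet> b) S" if "Ck_on k X S" for k
    using that
  proof (induction k arbitrary: X)
    case 0
    then show ?case
      by (auto intro: continuous_intros)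
  next
    case (Suc k)
    have der: "((\<lambda>x. X x \<bullet> b) has_derivative (\<lambda>v. frechet_derivative X (at x) v \<bullet> b)) (at x)"
      if "x \<in> S" for x
      using Suc.prems that
      by (intro has_derivative_inner_left) (simp_all flip: frechet_derivative_works)
    have "Ck_on k (\<lambda>x. frechet_derivative X (at x) v \<bullet> b) S" for v
      using Suc.prems by (intro Suc.IH) simp
    then have "Ck_on k (\<lambda>x. frechet_derivative (\<lambda>x. X x \<bullet> b) (at x) v) S" for v
      by (rule Ck_on_cong[OF \<open>open S\<close>, rotated]) (simp add: frechet_derivative_at[OF der, symmetric])
    with der show ?case
      by (auto simp: differentiable_def)
  qed
  with assms(2) show ?thesis
    by (simp add: smooth_on_def)
qed

lemma smooth_on_sum:
  assumes "open S" "finite B" "\<And>b. b \<in> B \<Longrightarrow> smooth_on S (f b)"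
  shows "smooth_on S (\<lambda>x. \<Sum>b\<in>B. f b x)"
  using assms(2,3)
  by (induction rule: finite_induct) (simp_all add: smooth_on_const smooth_on_add \<open>open S\<close>)

lemma smooth_on_imp_has_derivative:
  assumes "smooth_on S f" "x \<in> S"
  shows "(f has_derivative frechet_derivative f (at x)) (at x)"
proof -
  have "Ck_on (Suc 0) f S"
    using assms(1) unfolding smooth_on_def by blast
  with assms(2) show ?thesis
    by (simp flip: frechet_derivative_works)
qed

lemma smooth_on_frechet_derivative:
  assumes "smooth_on S f"
  shows "smooth_on S (\<lambda>x. frechet_derivative f (at x) v)"
  unfolding smooth_on_def
proof
  fix k
  have "Ck_on (Suc k) f S"
    using assms unfolding smooth_on_def by blast
  then show "Ck_on k (\<lambda>x. frechet_derivative f (at x) v) S"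
    by simp
qed

lemma smooth_on_imp_continuous_on: "smooth_on S f \<Longrightarrow> continuous_on S f"
  unfolding smooth_on_def by (metis Ck_on.simps(1))

section \<open>Second derivatives and their symmetry\<close>

text \<open>The iterated directional derivative, in the order in which \<open>half_hessian\<close> takes it:
  the inner derivative is in direction \<open>w\<close>, the outer one in direction
  \<open>v\<close>.\<close>

definition hess :: "('a::real_normed_vector \<Rightarrow> real) \<Rightarrow> 'a \<Rightarrow> 'a \<Rightarrow> 'a \<Rightarrow> real" where
  "hess f z v w = frechet_derivative (\<lambda>x. frechet_derivative f (at x) w) (at z) v"

lemma has_derivative_hess:
  assumes "smooth_on S f" "x \<in> S"
  shows "((\<lambda>x. frechet_derivative f (at x) w) has_derivative (\<lambda>v. hess f x v w)) (at x)"
  unfolding hess_def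
  using smooth_on_imp_has_derivative[OF smooth_on_frechet_derivative[OF assms(1)] assms(2)] .

lemma continuous_on_hess: "smooth_on S f \<Longrightarrow> continuous_on S (\<lambda>x. hess f x v w)"
  unfolding hess_def by (intro smooth_on_imp_continuous_on smooth_on_frechet_derivative)

lemma frechet_derivative_cong_on:
  assumes "open S" "x \<in> S" "\<And>y. y \<in> S \<Longrightarrow> f y = g y"
  shows "frechet_derivative f (at x) = frechet_derivative g (at x)"
proof -
  have "(f has_derivative D) (at x) \<longleftrightarrow> (g has_derivative D) (at x)" for D
    using assms has_derivative_transform_within_open by metis
  then show ?thesis
    by (simp add: frechet_derivative_def)
qed

lemma hess_linear_left:
  assumes "smooth_on S f" "z \<in> S"
  shows "linear (\<lambda>v. hess f z v w)"
  using has_derivative_hess[OF assms] by (rule has_derivative_linear)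

lemma hess_linear_right:
  assumes S: "open S" and f: "smooth_on S f" and z: "z \<in> S"
  shows "linear (\<lambda>w. hess f z v w)"
proof (rule linearI)
  fix w w' and r :: real
  have lin: "linear (frechet_derivative f (at x))" if "x \<in> S" for x
    using smooth_on_imp_has_derivative[OF f that] by (rule has_derivative_linear)
  have "frechet_derivative (\<lambda>x. frechet_derivative f (at x) (w + w')) (at z)
      = frechet_derivative (\<lambda>x. frechet_derivative f (at x) w + frechet_derivative f (at x) w') (at z)"
    using lin by (intro frechet_derivative_cong_on[OF S z]) (simp add: linear_add)
  also have "\<dots> = (\<lambda>v. hess f z v w + hess f z v w')"
    by (intro frechet_derivative_at[symmetric] has_derivative_add has_derivative_hess[OF f z])
  finally show "hess f z v (w + w') = hess f z v w + hess f z v w'"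
    by (simp add: hess_def)
  have "frechet_derivative (\<lambda>x. frechet_derivative f (at x) (r *\<^sub>R w)) (at z)
      = frechet_derivative (\<lambda>x. r *\<^sub>R frechet_derivative f (at x) w) (at z)"
    using lin by (intro frechet_derivative_cong_on[OF S z]) (simp add: linear_cmul)
  also have "\<dots> = (\<lambda>v. r *\<^sub>R hess f z v w)"
    by (intro frechet_derivative_at[symmetric] has_derivative_scaleR_right has_derivative_hess[OF f z])
  finally show "hess f z v (r *\<^sub>R w) = r *\<^sub>R hess f z v w"
    by (simp add: hess_def)
qed

text \<open>The symmetry of second derivatives comes from the second difference of \<open>f\<close> over a
  parallelogram: two applications of the mean value theorem turn it into one value of a mixed
  derivative, and the difference itself does not depend on the order of \<open>v\<close> and
  \<open>w\<close>.\<close>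

lemma second_difference_mvt:
  assumes f: "smooth_on S f" and t: "0 < t"
    and sub: "\<And>s r. 0 \<le> s \<Longrightarrow> s \<le> t \<Longrightarrow> 0 \<le> r \<Longrightarrow> r \<le> t \<Longrightarrow> z + s *\<^sub>R v + r *\<^sub>R w \<in> S"
  shows "\<exists>\<xi>\<in>{0..t}. \<exists>\<eta>\<in>{0..t}. f (z + t *\<^sub>R v + t *\<^sub>R w) - f (z + t *\<^sub>R v) - f (z + t *\<^sub>R w) + f z
           = t^2 * hess f (z + \<xi> *\<^sub>R v + \<eta> *\<^sub>R w) w v"
proof -
  let ?D = "\<lambda>x. frechet_derivative f (at x)"
  define \<phi> where "\<phi> s = f (z + s *\<^sub>R v + t *\<^sub>R w) - f (z + s *\<^sub>R v)" for s
  have d1: "((\<lambda>s. f (z + s *\<^sub>R v + r *\<^sub>R w)) has_field_derivative ?D (z + s *\<^sub>R v + r *\<^sub>R w) v) (at s)"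
    if "0 \<le> s" "s \<le> t" "0 \<le> r" "r \<le> t" for s r
  proof -
    have "((\<lambda>s. z + s *\<^sub>R v + r *\<^sub>R w) has_derivative (\<lambda>h. h *\<^sub>R v)) (at s)"
      by (auto intro!: derivative_eq_intros)
    from has_derivative_compose[OF this smooth_on_imp_has_derivative[OF f sub[OF that]]]
    have "((\<lambda>s. f (z + s *\<^sub>R v + r *\<^sub>R w)) has_derivative (\<lambda>h. ?D (z + s *\<^sub>R v + r *\<^sub>R w) (h *\<^sub>R v))) (at s)" .
    moreover have "linear (?D (z + s *\<^sub>R v + r *\<^sub>R w))"
      using smooth_on_imp_has_derivative[OF f sub[OF that]] by (rule has_derivative_linear)
    ultimately show ?thesis
      by (simp add: has_field_derivative_def linear_cmul mult_commute_abs)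
  qed
  have d2: "((\<lambda>r. ?D (z + s *\<^sub>R v + r *\<^sub>R w) v) has_field_derivative hess f (z + s *\<^sub>R v + r *\<^sub>R w) w v) (at r)"
    if "0 \<le> s" "s \<le> t" "0 \<le> r" "r \<le> t" for s r
  proof -
    have "((\<lambda>r. z + s *\<^sub>R v + r *\<^sub>R w) has_derivative (\<lambda>h. h *\<^sub>R w)) (at r)"
      by (auto intro!: derivative_eq_intros)
    from has_derivative_compose[OF this has_derivative_hess[OF f sub[OF that]]]
    have "((\<lambda>r. ?D (z + s *\<^sub>R v + r *\<^sub>R w) v) has_derivative (\<lambda>h. hess f (z + s *\<^sub>R v + r *\<^sub>R w) (h *\<^sub>R w) v)) (at r)" .
    moreover have "linear (\<lambda>w. hess f (z + s *\<^sub>R v + r *\<^sub>R w') w v)" if "w' = w" for w'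
      using hess_linear_left[OF f sub[OF \<open>0 \<le> s\<close> \<open>s \<le> t\<close> \<open>0 \<le> r\<close> \<open>r \<le> t\<close>]] that by simp
    from linear_cmul[OF this[OF refl]] have "hess f (z + s *\<^sub>R v + r *\<^sub>R w) (h *\<^sub>R w) v = h * hess f (z + s *\<^sub>R v + r *\<^sub>R w) w v" for h
      by simp
    ultimately show ?thesis
      by (simp add: has_field_derivative_def mult_commute_abs)
  qed
  have "\<exists>\<xi>. 0 < \<xi> \<and> \<xi> < t \<and> \<phi> t - \<phi> 0 = (t - 0) * (?D (z + \<xi> *\<^sub>R v + t *\<^sub>R w) v - ?D (z + \<xi> *\<^sub>R v) v)"
    unfolding \<phi>_def
    using d1[where r = t] d1[where r = 0] t
    by (intro MVT2 DERIV_diff) auto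
  then obtain \<xi> where \<xi>: "0 < \<xi>" "\<xi> < t"
    and 1: "\<phi> t - \<phi> 0 = t * (?D (z + \<xi> *\<^sub>R v + t *\<^sub>R w) v - ?D (z + \<xi> *\<^sub>R v) v)"
    by auto
  have "\<exists>\<eta>. 0 < \<eta> \<and> \<eta> < t \<and> ?D (z + \<xi> *\<^sub>R v + t *\<^sub>R w) v - ?D (z + \<xi> *\<^sub>R v + 0 *\<^sub>R w) v
      = (t - 0) * hess f (z + \<xi> *\<^sub>R v + \<eta> *\<^sub>R w) w v"
    using d2[where s = \<xi>] t \<xi> by (intro MVT2) auto
  then obtain \<eta> where \<eta>: "0 < \<eta>" "\<eta> < t"
    and 2: "?D (z + \<xi> *\<^sub>R v + t *\<^sub>R w) v - ?D (z + \<xi> *\<^sub>R v) v = t * hess f (z + \<xi> *\<^sub>R v + \<eta> *\<^sub>R w) w v"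
    by auto
  have "f (z + t *\<^sub>R v + t *\<^sub>R w) - f (z + t *\<^sub>R v) - f (z + t *\<^sub>R w) + f z = \<phi> t - \<phi> 0"
    by (simp add: \<phi>_def)
  also have "\<dots> = t^2 * hess f (z + \<xi> *\<^sub>R v + \<eta> *\<^sub>R w) w v"
    by (simp only: 1 2 power2_eq_square mult.assoc)
  finally show ?thesis
    using \<xi> \<eta> by (intro bexI[of _ \<xi>] bexI[of _ \<eta>]) auto
qed

text \<open>By \<open>second_difference_mvt\<close>, in both orders, the two mixed derivatives agree at
  points \<open>x\<close> and \<open>y\<close> arbitrarily close to \<open>z\<close>; their
  continuity carries the equality over to \<open>z\<close>.\<close>

lemma hess_symmetric:
  assumes S: "open S" and f: "smooth_on S f" and z: "z \<in> S"
  shows "hess f z v w = hess f z w v"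
proof -
  obtain e where e: "e > 0" "ball z e \<subseteq> S"
    using S z open_contains_ball by blast
  \<comment> \<open>The parallelogram at \<open>z\<close> with sides \<open>t v\<close> and \<open>t w\<close> stays within distance \<open>t B\<close> of \<open>z\<close>;
    the summand 1 makes \<open>B\<close> positive.\<close>
  define B where "B = norm v + norm w + 1"
  have "B > 0"
    by (simp add: B_def add_nonneg_pos)
  have dist: "dist z (z + s *\<^sub>R v + r *\<^sub>R w) \<le> t * B"
    if "0 \<le> s" "s \<le> t" "0 \<le> r" "r \<le> t" for s r t
  proof -
    have "norm (s *\<^sub>R v + r *\<^sub>R w) \<le> s * norm v + r * norm w"
      using that by (metis abs_of_nonneg norm_scaleR norm_triangle_ineq)
    also have "\<dots> \<le> t * norm v + t * norm w"
      using that by (intro add_mono mult_right_mono) auto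
    also have "\<dots> \<le> t * B"
      using that by (simp add: B_def algebra_simps)
    finally show ?thesis
      by (metis add.assoc add.right_neutral dist_0_norm dist_add_cancel)
  qed
  have close: "\<exists>x y. dist z x \<le> t * B \<and> dist z y \<le> t * B \<and> x \<in> S \<and> y \<in> S \<and> hess f x v w = hess f y w v"
    if t: "0 < t" "t * B < e" for t
  proof -
    have inS: "z + s *\<^sub>R v + r *\<^sub>R w \<in> S" if "0 \<le> s" "s \<le> t" "0 \<le> r" "r \<le> t" for s r
      using dist[OF that] t e by (auto simp: subset_iff)
    then have inS': "z + s *\<^sub>R w + r *\<^sub>R v \<in> S" if "0 \<le> s" "s \<le> t" "0 \<le> r" "r \<le> t" for s r
      using that by (metis add.assoc add.commute)
    obtain \<xi> \<eta> where 1: "\<xi> \<in> {0..t}" "\<eta> \<in> {0..t}"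
      "f (z + t *\<^sub>R v + t *\<^sub>R w) - f (z + t *\<^sub>R v) - f (z + t *\<^sub>R w) + f z
           = t^2 * hess f (z + \<xi> *\<^sub>R v + \<eta> *\<^sub>R w) w v"
      using second_difference_mvt[OF f t(1) inS] by blast
    obtain \<xi>' \<eta>' where 2: "\<xi>' \<in> {0..t}" "\<eta>' \<in> {0..t}"
      "f (z + t *\<^sub>R w + t *\<^sub>R v) - f (z + t *\<^sub>R w) - f (z + t *\<^sub>R v) + f z
           = t^2 * hess f (z + \<xi>' *\<^sub>R w + \<eta>' *\<^sub>R v) v w"
      using second_difference_mvt[OF f t(1) inS'] by blast
    have "z + t *\<^sub>R w + t *\<^sub>R v = z + t *\<^sub>R v + t *\<^sub>R w"
      by simp
    from 1(3) 2(3)[unfolded this]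
    have "t^2 * hess f (z + \<xi>' *\<^sub>R w + \<eta>' *\<^sub>R v) v w = t^2 * hess f (z + \<xi> *\<^sub>R v + \<eta> *\<^sub>R w) w v"
      by linarith
    moreover have "z + \<xi>' *\<^sub>R w + \<eta>' *\<^sub>R v = z + \<eta>' *\<^sub>R v + \<xi>' *\<^sub>R w"
      by simp
    ultimately have "hess f (z + \<eta>' *\<^sub>R v + \<xi>' *\<^sub>R w) v w = hess f (z + \<xi> *\<^sub>R v + \<eta> *\<^sub>R w) w v"
      using t(1) by simp
    with 1 2 dist inS show ?thesis
      by (intro exI[of _ "z + \<eta>' *\<^sub>R v + \<xi>' *\<^sub>R w"] exI[of _ "z + \<xi> *\<^sub>R v + \<eta> *\<^sub>R w"]) auto
  qed
  have "\<forall>\<epsilon>>0. \<bar>hess f z v w - hess f z w v\<bar> \<le> 2 * \<epsilon>"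
  proof (intro allI impI)
    fix \<epsilon> :: real
    assume "\<epsilon> > 0"
    have cont: "\<exists>d>0. \<forall>x\<in>S. dist x z < d \<longrightarrow> dist (hess f x a b) (hess f z a b) < \<epsilon>" for a b
      using continuous_on_hess[OF f, of a b] z \<open>\<epsilon> > 0\<close> unfolding continuous_on_iff by blast
    obtain d1 where d1: "d1 > 0" "\<And>x. x \<in> S \<Longrightarrow> dist x z < d1 \<Longrightarrow> dist (hess f x v w) (hess f z v w) < \<epsilon>"
      using cont by blast
    obtain d2 where d2: "d2 > 0" "\<And>x. x \<in> S \<Longrightarrow> dist x z < d2 \<Longrightarrow> dist (hess f x w v) (hess f z w v) < \<epsilon>"
      using cont by blast
    define t where "t = min e (min d1 d2) / (2 * B)"
    have "t > 0"
      using e d1 d2 \<open>B > 0\<close> by (simp add: t_def)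
    have tB: "t * B = min e (min d1 d2) / 2"
      using \<open>B > 0\<close> by (simp add: t_def)
    with e d1 d2 have tB': "t * B < e" "t * B < d1" "t * B < d2"
      by auto
    obtain x y where "dist z x \<le> t * B" "dist z y \<le> t * B" "x \<in> S" "y \<in> S" "hess f x v w = hess f y w v"
      using close[OF \<open>t > 0\<close> tB'(1)] by blast
    with d1(2)[of x] d2(2)[of y] tB' show "\<bar>hess f z v w - hess f z w v\<bar> \<le> 2 * \<epsilon>"
      by (simp add: dist_commute dist_real_def)
  qed
  have "\<bar>hess f z v w - hess f z w v\<bar> \<le> 0"
  proof (rule field_le_epsilon)
    fix e :: real
    assume "e > 0"
    then show "\<bar>hess f z v w - hess f z w v\<bar> \<le> 0 + e"
      using \<open>\<forall>\<epsilon>>0. _\<close>[rule_format, of "e / 2"] by simp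
  qed
  then show ?thesis
    by simp
qed

section \<open>Hessian metrics of potentials of degree two\<close>

text \<open>Euler's theorem: differentiate \<open>h (r z) = r\<^sup>k h z\<close> with respect to
  \<open>r\<close> at \<open>r = 1\<close>.\<close>

lemma euler_homogeneous:
  fixes h :: "'a::real_normed_vector \<Rightarrow> real"
  assumes der: "(h has_derivative h') (at z)" and hom: "\<And>r. r > 0 \<Longrightarrow> h (r *\<^sub>R z) = r ^ k * h z"
  shows "h' z = real k * h z"
proof -
  have "((\<lambda>r. r *\<^sub>R z) has_derivative (\<lambda>h. h *\<^sub>R z)) (at 1)"
    by (auto intro!: derivative_eq_intros)
  from has_derivative_compose[OF this, of h h'] der
  have "((\<lambda>r. h (r *\<^sub>R z)) has_derivative (\<lambda>s. h' (s *\<^sub>R z))) (at 1)"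
    by simp
  then have "((\<lambda>r. h (r *\<^sub>R z)) has_field_derivative h' z) (at 1)"
    using has_derivative_linear[OF der]
    by (simp add: has_field_derivative_def linear_cmul mult_commute_abs)
  then have "((\<lambda>r. r ^ k * h z) has_field_derivative h' z) (at 1)"
    by (rule has_field_derivative_transform_within_open[of _ _ _ "{0<..}"]) (auto simp: hom)
  moreover have "((\<lambda>r. r ^ k * h z) has_field_derivative real k * h z) (at 1)"
    by (auto intro!: derivative_eq_intros)
  ultimately show ?thesis
    by (rule DERIV_unique)
qed

text \<open>Differentiation lowers the degree of homogeneity by one: differentiate \<open>h (r x) =
  r\<^bsup>k+1\<^esup> h x\<close> with respect to \<open>x\<close> and cancel a factor
  \<open>r\<close>.\<close>

lemma frechet_derivative_homogeneous:
  fixes h :: "'a::real_normed_vector \<Rightarrow> real"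
  assumes C: "open C" "z \<in> C" "r *\<^sub>R z \<in> C" and r: "r > 0" and h: "smooth_on C h"
    and hom: "\<And>x. x \<in> C \<Longrightarrow> h (r *\<^sub>R x) = r ^ Suc k * h x"
  shows "frechet_derivative h (at (r *\<^sub>R z)) v = r ^ k * frechet_derivative h (at z) v"
proof -
  let ?D = "\<lambda>x. frechet_derivative h (at x)"
  have lin: "linear (?D (r *\<^sub>R z))"
    using smooth_on_imp_has_derivative[OF h C(3)] by (rule has_derivative_linear)
  have "((\<lambda>x. r *\<^sub>R x) has_derivative (\<lambda>v. r *\<^sub>R v)) (at z)"
    by (auto intro!: derivative_eq_intros)
  from has_derivative_compose[OF this smooth_on_imp_has_derivative[OF h C(3)]]
  have "((\<lambda>x. h (r *\<^sub>R x)) has_derivative (\<lambda>v. ?D (r *\<^sub>R z) (r *\<^sub>R v))) (at z)" .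
  then have "((\<lambda>x. r ^ Suc k * h x) has_derivative (\<lambda>v. ?D (r *\<^sub>R z) (r *\<^sub>R v))) (at z)"
    using C(1,2) by (rule has_derivative_transform_within_open) (rule hom)
  moreover have "((\<lambda>x. r ^ Suc k * h x) has_derivative (\<lambda>v. r ^ Suc k * ?D z v)) (at z)"
    by (intro has_derivative_mult_right smooth_on_imp_has_derivative[OF h C(2)])
  ultimately have "(\<lambda>v. ?D (r *\<^sub>R z) (r *\<^sub>R v)) = (\<lambda>v. r ^ Suc k * ?D z v)"
    by (rule has_derivative_unique)
  from fun_cong[OF this, of v] have "r * ?D (r *\<^sub>R z) v = r * (r ^ k * ?D z v)"
    by (simp add: linear_cmul[OF lin] mult.assoc)
  with r show ?thesis
    by simp
qed

text \<open>The cone excludes its vertex because \<open>\<Phi>\<close>, and with it the length of the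
  position vector, vanishes there, while elsewhere both are positive.\<close>

locale homogeneous_potential =
  fixes C :: "'a::euclidean_space set" and \<Phi> :: "'a \<Rightarrow> real"
  assumes open_C: "open C"
    and cone: "z \<in> C \<Longrightarrow> r > 0 \<Longrightarrow> r *\<^sub>R z \<in> C"
    and zero_notin_C: "0 \<notin> C"
    and smooth: "smooth_on C \<Phi>"
    and homogeneous: "z \<in> C \<Longrightarrow> r > 0 \<Longrightarrow> \<Phi> (r *\<^sub>R z) = r\<^sup>2 * \<Phi> z"
    and hess_pos: "z \<in> C \<Longrightarrow> w \<noteq> 0 \<Longrightarrow> hess \<Phi> z w w > 0"
begin

abbreviation d\<Phi> :: "'a \<Rightarrow> 'a \<Rightarrow> real" where
  "d\<Phi> z \<equiv> frechet_derivative \<Phi> (at z)"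

lemma has_derivative_potential: "z \<in> C \<Longrightarrow> (\<Phi> has_derivative d\<Phi> z) (at z)"
  using smooth by (rule smooth_on_imp_has_derivative)

lemma linear_d: "z \<in> C \<Longrightarrow> linear (d\<Phi> z)"
  using has_derivative_potential by (rule has_derivative_linear)

lemmas has_derivative_d = has_derivative_hess[OF smooth]

lemmas metric_linear_left = hess_linear_left[OF smooth]

lemmas metric_linear_right = hess_linear_right[OF open_C smooth]

lemmas metric_symmetric = hess_symmetric[OF open_C smooth]

lemma d_homogeneous:
  assumes "z \<in> C" "r > 0"
  shows "d\<Phi> (r *\<^sub>R z) w = r * d\<Phi> z w"
proof -
  have "d\<Phi> (r *\<^sub>R z) w = r ^ 1 * d\<Phi> z w"
    using assms
    by (intro frechet_derivative_homogeneous[OF open_C] smooth cone)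
       (simp_all add: homogeneous power2_eq_square)
  then show ?thesis
    by simp
qed

lemma metric_homogeneous:
  assumes z: "z \<in> C" and r: "r > 0"
  shows "hess \<Phi> (r *\<^sub>R z) v w = hess \<Phi> z v w"
proof -
  have "d\<Phi> (r *\<^sub>R x) w = r ^ Suc 0 * d\<Phi> x w" if "x \<in> C" for x
    using that r by (simp add: d_homogeneous)
  from frechet_derivative_homogeneous[OF open_C z cone[OF z r] r smooth_on_frechet_derivative[OF smooth] this]
  show ?thesis
    by (simp add: hess_def)
qed

lemma euler_potential: "z \<in> C \<Longrightarrow> d\<Phi> z z = 2 * \<Phi> z"
  using euler_homogeneous[OF has_derivative_potential, of z 2] by (simp add: homogeneous)

lemma metric_position_left: "z \<in> C \<Longrightarrow> hess \<Phi> z z w = d\<Phi> z w"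
  using euler_homogeneous[OF has_derivative_d, of z w 1] by (simp add: d_homogeneous)

lemma metric_position_right: "z \<in> C \<Longrightarrow> hess \<Phi> z v z = d\<Phi> z v"
  using metric_position_left metric_symmetric by metis

text \<open>The metric coefficients are homogeneous of degree 0, so Euler's theorem makes their radial
  derivative vanish.\<close>

lemma metric_radially_constant:
  assumes "z \<in> C"
  shows "frechet_derivative (\<lambda>x. hess \<Phi> x v w) (at z) z = 0"
proof -
  have "smooth_on C (\<lambda>x. hess \<Phi> x v w)"
    unfolding hess_def by (intro smooth_on_frechet_derivative smooth)
  from euler_homogeneous[OF smooth_on_imp_has_derivative[OF this assms], of 0]
  show ?thesis
    using assms by (simp add: metric_homogeneous)
qed

lemma potential_pos: "z \<in> C \<Longrightarrow> \<Phi> z > 0"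
  using hess_pos[of z z] metric_position_left[of z z] euler_potential[of z] zero_notin_C by fastforce

lemma metric_nondegenerate:
  assumes "z \<in> C" and "\<And>w. hess \<Phi> z v w = hess \<Phi> z v' w"
  shows "v = v'"
proof -
  have "hess \<Phi> z (v - v') w = 0" for w
    using assms linear_diff[OF metric_linear_left[OF assms(1)]] by simp
  then show ?thesis
    using hess_pos[OF assms(1), of "v - v'"] by fastforce
qed

text \<open>Induction on \<open>k\<close>: the Riesz representatives (for the Euclidean inner product) of
  the functionals \<open>hess \<Phi> z _ z\<close> and \<open>hess \<Phi> z _ (e i)\<close> span
  at most \<open>k + 1\<close> dimensions, so as long as there is room some nonzero vector is
  annihilated by all of them, and it only has to be normalised.\<close>

lemma orthonormal_complement_of_position:
  assumes z: "z \<in> C" and "k < DIM('a)"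
  shows "\<exists>e. \<forall>i\<in>{1..k}. hess \<Phi> z (e i) z = 0 \<and>
           (\<forall>j\<in>{1..k}. hess \<Phi> z (e i) (e j) = (if i = j then 1 else 0))"
  using assms(2)
proof (induction k)
  case 0
  then show ?case
    by simp
next
  case (Suc k)
  then obtain e where IH: "\<forall>i\<in>{1..k}. hess \<Phi> z (e i) z = 0 \<and>
           (\<forall>j\<in>{1..k}. hess \<Phi> z (e i) (e j) = (if i = j then 1 else 0))"
    by (metis Suc_lessD)
  then have e: "\<And>i. i \<in> {1..k} \<Longrightarrow> hess \<Phi> z (e i) z = 0"
    "\<And>i j. i \<in> {1..k} \<Longrightarrow> j \<in> {1..k} \<Longrightarrow> hess \<Phi> z (e i) (e j) = (if i = j then 1 else 0)"
    by blast+
  define rep where "rep w = (\<Sum>b\<in>Basis. hess \<Phi> z b w *\<^sub>R b)" for w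
  have rep: "hess \<Phi> z v w = v \<bullet> rep w" for v w
  proof -
    have "hess \<Phi> z v w = hess \<Phi> z (\<Sum>b\<in>Basis. (v \<bullet> b) *\<^sub>R b) w"
      by (simp add: euclidean_representation)
    also have "\<dots> = v \<bullet> rep w"
      using metric_linear_left[OF z]
      by (simp add: linear_sum[of "\<lambda>v. hess \<Phi> z v w"] linear_cmul[of "\<lambda>v. hess \<Phi> z v w"]
          rep_def inner_sum_right mult.commute)
    finally show ?thesis .
  qed
  let ?W = "insert (rep z) ((rep \<circ> e) ` {1..k})"
  have "card ?W \<le> Suc (card ((rep \<circ> e) ` {1..k}))"
    by (simp add: card_insert_le_m1 card_insert_if)
  also have "\<dots> \<le> Suc k"
    using card_image_le[of "{1..k}" "rep \<circ> e"] by simp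
  finally have "dim ?W < DIM('a)"
    using Suc.prems dim_le_card'[of ?W] by simp
  then obtain x where x: "x \<noteq> 0" "\<And>y. y \<in> span ?W \<Longrightarrow> orthogonal x y"
    by (rule orthogonal_to_subspace_exists[of ?W]) blast
  have xz: "hess \<Phi> z x z = 0"
    using x(2)[of "rep z"] by (simp add: rep orthogonal_def span_base)
  have xe: "hess \<Phi> z x (e i) = 0" if "i \<in> {1..k}" for i
    using x(2)[of "rep (e i)"] that by (simp add: rep orthogonal_def span_base)
  define s where "s = hess \<Phi> z x x"
  have "s > 0"
    using hess_pos[OF z x(1)] by (simp add: s_def)
  define n where "n = (1 / sqrt s) *\<^sub>R x"
  have nl: "hess \<Phi> z n w = (1 / sqrt s) * hess \<Phi> z x w" for w
    unfolding n_def using linear_cmul[OF metric_linear_left[OF z]] by simp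
  have nr: "hess \<Phi> z w n = (1 / sqrt s) * hess \<Phi> z x w" for w
    using nl metric_symmetric[OF z] by metis
  have nn: "hess \<Phi> z n n = 1"
    using \<open>s > 0\<close> by (simp add: nl nr flip: s_def)
  show ?case
  proof (intro exI[of _ "e(Suc k := n)"] ballI conjI)
    fix i j
    assume ij: "i \<in> {1..Suc k}" "j \<in> {1..Suc k}"
    show "hess \<Phi> z ((e(Suc k := n)) i) ((e(Suc k := n)) j) = (if i = j then 1 else 0)"
      using ij e(2) nl[of "e j"] nr[of "e i"] xe nn by (auto simp: le_Suc_eq)
  next
    fix i
    assume "i \<in> {1..Suc k}"
    then show "hess \<Phi> z ((e(Suc k := n)) i) z = 0"
      using e(1) nl xz by (auto simp: le_Suc_eq)
  qed
qed

text \<open>Homogeneity makes curves in the level sets of \<open>\<Phi>\<close> explicit: multiplying the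
  points of the segment \<open>z + s w\<close> by \<open>sqrt (\<Phi> z / \<Phi> (z + s
  w))\<close> brings them back to the level of \<open>z\<close>, and the multiplier has derivative
  0 at \<open>s = 0\<close> because \<open>d\<Phi> z w = 0\<close>.\<close>

lemma level_curve:
  assumes z: "z \<in> C" and w: "d\<Phi> z w = 0"
  obtains \<epsilon> :: real and \<zeta> \<zeta>' where "\<epsilon> > 0" "\<zeta> 0 = z" "\<zeta>' 0 = w" "continuous_on {0..\<epsilon>} \<zeta>'"
    "\<forall>s\<in>{0..\<epsilon>}. \<zeta> s \<in> C \<and> d\<Phi> (\<zeta> s) (\<zeta>' s) = 0 \<and> (\<zeta> has_vector_derivative \<zeta>' s) (at s)"
proof -
  define J where "J = (\<lambda>s::real. z + s *\<^sub>R w) -` C"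
  have "open J"
    unfolding J_def by (intro open_vimage open_C continuous_intros)
  moreover have "0 \<in> J"
    using z by (simp add: J_def)
  ultimately obtain \<epsilon> where \<epsilon>: "\<epsilon> > 0" "cball 0 \<epsilon> \<subseteq> J"
    using open_contains_cball by blast
  define \<psi> where "\<psi> s = \<Phi> (z + s *\<^sub>R w)" for s
  define \<psi>' where "\<psi>' s = d\<Phi> (z + s *\<^sub>R w) w" for s
  have pos: "\<psi> s > 0" if "s \<in> J" for s
    using that by (simp add: J_def \<psi>_def potential_pos)
  have d\<psi>: "(\<psi> has_field_derivative \<psi>' s) (at s)" if "s \<in> J" for s
  proof -
    have inC: "z + s *\<^sub>R w \<in> C"
      using that by (simp add: J_def)
    have "((\<lambda>s. z + s *\<^sub>R w) has_derivative (\<lambda>h. h *\<^sub>R w)) (at s)"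
      by (auto intro!: derivative_eq_intros)
    from has_derivative_compose[OF this has_derivative_potential[OF inC]]
    show ?thesis
      unfolding \<psi>_def \<psi>'_def has_field_derivative_def
      by (simp add: linear_cmul[OF linear_d[OF inC]] mult_commute_abs)
  qed
  have cont: "continuous_on J \<psi>" "continuous_on J \<psi>'"
    unfolding \<psi>_def \<psi>'_def J_def
    by (intro continuous_on_compose2[OF smooth_on_imp_continuous_on[OF smooth]]
        continuous_on_compose2[OF smooth_on_imp_continuous_on[OF smooth_on_frechet_derivative[OF smooth]]]
        continuous_intros; auto)+
  define m where "m s = sqrt (\<Phi> z / \<psi> s)" for s
  define m' where "m' s = - (\<Phi> z * \<psi>' s / (\<psi> s)\<^sup>2) * (inverse (m s) / 2)" for s
  have \<Phi>z: "\<Phi> z > 0"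
    using z by (rule potential_pos)
  have m_pos: "m s > 0" if "s \<in> J" for s
    using pos[OF that] \<Phi>z by (simp add: m_def)
  have dm: "(m has_field_derivative m' s) (at s)" if "s \<in> J" for s
    unfolding m_def[abs_def] m'_def
    using pos[OF that] \<Phi>z
    by (auto intro!: derivative_eq_intros d\<psi>[OF that] simp: power2_eq_square field_simps)
  define \<zeta> where "\<zeta> s = m s *\<^sub>R (z + s *\<^sub>R w)" for s
  define \<zeta>' where "\<zeta>' s = m s *\<^sub>R w + m' s *\<^sub>R (z + s *\<^sub>R w)" for s
  have d\<zeta>: "(\<zeta> has_vector_derivative \<zeta>' s) (at s)" if "s \<in> J" for s
    unfolding \<zeta>_def[abs_def] \<zeta>'_def
    by (rule has_vector_derivative_scaleR[OF dm[OF that]]) (auto intro!: derivative_eq_intros)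
  have inC: "\<zeta> s \<in> C" if "s \<in> J" for s
    unfolding \<zeta>_def using that m_pos[OF that] by (intro cone) (auto simp: J_def)
  have level: "\<Phi> (\<zeta> s) = \<Phi> z" if "s \<in> J" for s
  proof -
    have "\<Phi> (\<zeta> s) = (m s)\<^sup>2 * \<psi> s"
      unfolding \<zeta>_def \<psi>_def using that m_pos[OF that] by (intro homogeneous) (auto simp: J_def)
    then show ?thesis
      using pos[OF that] \<Phi>z by (simp add: m_def)
  qed
  have tangent: "d\<Phi> (\<zeta> s) (\<zeta>' s) = 0" if "s \<in> J" for s
  proof -
    have "((\<lambda>s. \<Phi> (\<zeta> s)) has_derivative (\<lambda>h. d\<Phi> (\<zeta> s) (h *\<^sub>R \<zeta>' s))) (at s)"
      using d\<zeta>[OF that] has_derivative_potential[OF inC[OF that]]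
      unfolding has_vector_derivative_def by (rule has_derivative_compose)
    then have "((\<lambda>s. \<Phi> z) has_derivative (\<lambda>h. d\<Phi> (\<zeta> s) (h *\<^sub>R \<zeta>' s))) (at s)"
      using \<open>open J\<close> that by (rule has_derivative_transform_within_open) (rule level)
    then have "(\<lambda>h. d\<Phi> (\<zeta> s) (h *\<^sub>R \<zeta>' s)) = (\<lambda>h. 0)"
      by (rule has_derivative_unique) (rule has_derivative_const)
    from fun_cong[OF this, of 1] show ?thesis
      by simp
  qed
  have sub: "{0..\<epsilon>} \<subseteq> J"
    using \<epsilon>(2) by (auto simp: subset_iff dist_real_def)
  have "continuous_on J \<zeta>'"
    unfolding \<zeta>'_def m'_def m_def using pos \<Phi>z
    by (intro continuous_intros cont) (auto simp: less_imp_neq[THEN not_sym] less_imp_le dest!: pos)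
  then have "continuous_on {0..\<epsilon>} \<zeta>'"
    using sub by (rule continuous_on_subset)
  moreover have "\<zeta> 0 = z" "\<zeta>' 0 = w"
    using \<Phi>z w by (simp_all add: \<zeta>_def \<zeta>'_def m_def m'_def \<psi>_def \<psi>'_def)
  ultimately show ?thesis
    using that[of \<epsilon> \<zeta> \<zeta>'] \<epsilon>(1) sub inC tangent d\<zeta> by blast
qed

text \<open>The metric product of a smooth field with the position field has to be differentiable before it
  can be differentiated along a leaf; in components it is \<open>\<Sum>\<^sub>b Y\<^sup>b
  \<partial>\<^sub>b \<Phi>\<close>.\<close>

lemma smooth_on_d_field:
  assumes "open \<Omega>" "\<Omega> \<subseteq> C" "smooth_on \<Omega> Y"
  shows "smooth_on \<Omega> (\<lambda>w. d\<Phi> w (Y w))"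
proof -
  have "smooth_on \<Omega> (\<lambda>w. \<Sum>b\<in>Basis. (Y w \<bullet> b) *\<^sub>R d\<Phi> w b)"
    using assms smooth_on_subset[OF smooth]
    by (intro smooth_on_sum smooth_on_scaleR smooth_on_inner_const smooth_on_frechet_derivative) auto
  moreover have "(\<Sum>b\<in>Basis. (Y w \<bullet> b) *\<^sub>R d\<Phi> w b) = d\<Phi> w (Y w)" if "w \<in> \<Omega>" for w
  proof -
    have "d\<Phi> w (Y w) = d\<Phi> w (\<Sum>b\<in>Basis. (Y w \<bullet> b) *\<^sub>R b)"
      by (simp add: euclidean_representation)
    also have "\<dots> = (\<Sum>b\<in>Basis. (Y w \<bullet> b) *\<^sub>R d\<Phi> w b)"
      using linear_d[of w] that assms(2) by (subst linear_sum) (auto simp: linear_cmul)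
    finally show ?thesis ..
  qed
  ultimately show ?thesis
    by (rule smooth_on_cong[OF assms(1), rotated])
qed

end

section \<open>The Levi-Civita connection of a homogeneous Hessian metric\<close>

locale hessian_connection = homogeneous_potential +
  fixes \<Omega> nabla
  assumes open_\<Omega>: "open \<Omega>" and \<Omega>_subset: "\<Omega> \<subseteq> C"
    and connection: "levi_civita \<Omega> (hess \<Phi>) nabla"
begin

lemma in_C: "u \<in> \<Omega> \<Longrightarrow> u \<in> C"
  using \<Omega>_subset by blast

lemma torsion_free:
  assumes "smooth_on \<Omega> X" "smooth_on \<Omega> Y" "u \<in> \<Omega>"
  shows "nabla X Y u - nabla Y X u = lie_bracket X Y u"
  using connection assms unfolding levi_civita_def by blast

lemma metric_compatible:
  assumes "smooth_on \<Omega> X" "smooth_on \<Omega> Y" "smooth_on \<Omega> Z" "u \<in> \<Omega>"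
  shows "frechet_derivative (\<lambda>w. hess \<Phi> w (Y w) (Z w)) (at u) (X u)
      = hess \<Phi> u (nabla X Y u) (Z u) + hess \<Phi> u (Y u) (nabla X Z u)"
  using connection assms unfolding levi_civita_def by blast

lemma smooth_on_const_position: "smooth_on \<Omega> (\<lambda>_. x)" "smooth_on \<Omega> (\<lambda>w. w)"
  by (simp_all add: smooth_on_const smooth_on_ident)

text \<open>Pairing with the position field undoes one differentiation of \<open>\<Phi>\<close>, so
  differentiating the result gives back the metric. Symmetry in \<open>v\<close> and
  \<open>x\<close> is what makes the Koszul formula collapse.\<close>

lemma derivative_metric_position:
  assumes "u \<in> \<Omega>"
  shows "frechet_derivative (\<lambda>w. hess \<Phi> w w x) (at u) v = hess \<Phi> u v x"
    and "frechet_derivative (\<lambda>w. hess \<Phi> w x w) (at u) v = hess \<Phi> u v x"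
proof -
  have "frechet_derivative (\<lambda>w. hess \<Phi> w w x) (at u) = frechet_derivative (\<lambda>w. d\<Phi> w x) (at u)"
    by (intro frechet_derivative_cong_on[OF open_\<Omega> assms] metric_position_left in_C)
  then show "frechet_derivative (\<lambda>w. hess \<Phi> w w x) (at u) v = hess \<Phi> u v x"
    by (simp add: hess_def)
  have "frechet_derivative (\<lambda>w. hess \<Phi> w x w) (at u) = frechet_derivative (\<lambda>w. d\<Phi> w x) (at u)"
    by (intro frechet_derivative_cong_on[OF open_\<Omega> assms] metric_position_right in_C)
  then show "frechet_derivative (\<lambda>w. hess \<Phi> w x w) (at u) v = hess \<Phi> u v x"
    by (simp add: hess_def)
qed

text \<open>The Koszul formula for the fields \<open>x\<close>, \<open>E\<close> and \<open>z\<close>, where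
  \<open>x\<close> and \<open>z\<close> are constant and \<open>E\<close> is the position field.
  Of the three derivatives of metric products, the one along \<open>E\<close> vanishes and the
  other two cancel; the brackets \<open>[x, E] = x\<close> and \<open>[z, E] = z\<close> give
  twice the product of \<open>x\<close> and \<open>z\<close>.\<close>

lemma nabla_const_position:
  assumes u: "u \<in> \<Omega>"
  shows "nabla (\<lambda>_. x) (\<lambda>w. w) u = x"
proof (rule metric_nondegenerate[OF in_C[OF u]])
  fix z :: 'a
  note smooth' = smooth_on_const_position
  let ?g = "hess \<Phi> u" and ?E = "\<lambda>w::'a. w"
  let ?x = "\<lambda>_::'a. x" and ?z = "\<lambda>_::'a. z"
  have m1: "?g x z = ?g (nabla ?x ?E u) z + ?g u (nabla ?x ?z u)"
    using metric_compatible[OF smooth'(1,2,1) u] derivative_metric_position(1)[OF u] by metis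
  have m2: "0 = ?g (nabla ?E ?x u) z + ?g x (nabla ?E ?z u)"
    using metric_compatible[OF smooth'(2,1,1) u, of x z] metric_radially_constant[OF in_C[OF u]] by simp
  have m3: "?g z x = ?g (nabla ?z ?x u) u + ?g x (nabla ?z ?E u)"
    using metric_compatible[OF smooth'(1,1,2) u] derivative_metric_position(2)[OF u] by metis
  have t1: "nabla ?x ?E u - nabla ?E ?x u = x"
    using torsion_free[OF smooth'(1,2) u] by (simp add: lie_bracket_def)
  have t2: "nabla ?x ?z u = nabla ?z ?x u"
    using torsion_free[OF smooth'(1,1) u, of x z] by (simp add: lie_bracket_def)
  have t3: "nabla ?z ?E u - nabla ?E ?z u = z"
    using torsion_free[OF smooth'(1,2) u] by (simp add: lie_bracket_def)
  have "?g (nabla ?x ?E u) z - ?g (nabla ?E ?x u) z = ?g x z"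
    using linear_diff[OF metric_linear_left[OF in_C[OF u]], of "nabla ?x ?E u" "nabla ?E ?x u" z] t1 by simp
  moreover have "?g x (nabla ?z ?E u) - ?g x (nabla ?E ?z u) = ?g x z"
    using linear_diff[OF metric_linear_right[OF in_C[OF u]], of x "nabla ?z ?E u" "nabla ?E ?z u"] t3 by simp
  moreover have "?g u (nabla ?x ?z u) = ?g (nabla ?z ?x u) u" "?g z x = ?g x z"
    using t2 metric_symmetric[OF in_C[OF u]] by metis+
  ultimately show "?g (nabla ?x ?E u) z = ?g x z"
    using m1 m2 m3 by linarith
qed

lemma nabla_linear_left:
  assumes "smooth_on \<Omega> f" "smooth_on \<Omega> h" "smooth_on \<Omega> X" "smooth_on \<Omega> X'" "smooth_on \<Omega> Y" "u \<in> \<Omega>"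
  shows "nabla (\<lambda>w. f w *\<^sub>R X w + h w *\<^sub>R X' w) Y u = f u *\<^sub>R nabla X Y u + h u *\<^sub>R nabla X' Y u"
proof -
  have "\<forall>f h X X' Y. smooth_on \<Omega> (f :: 'a \<Rightarrow> real) \<and> smooth_on \<Omega> (h :: 'a \<Rightarrow> real) \<and>
        smooth_on \<Omega> X \<and> smooth_on \<Omega> X' \<and> smooth_on \<Omega> Y \<longrightarrow>
        (\<forall>u\<in>\<Omega>. nabla (\<lambda>w. f w *\<^sub>R X w + h w *\<^sub>R X' w) Y u
                = f u *\<^sub>R nabla X Y u + h u *\<^sub>R nabla X' Y u)"
    using connection unfolding levi_civita_def affine_connection_def by (elim conjE)
  with assms show ?thesis
    by blast
qed

text \<open>From constant fields to arbitrary ones: a connection is linear over functions in its first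
  argument, and \<open>X\<close> is a combination of constant fields.\<close>

lemma nabla_position:
  assumes X: "smooth_on \<Omega> X" and u: "u \<in> \<Omega>"
  shows "nabla X (\<lambda>w. w) u = X u"
proof -
  let ?E = "\<lambda>w::'a. w"
  have "nabla (\<lambda>w. \<Sum>b\<in>B. (X w \<bullet> b) *\<^sub>R b) ?E u = (\<Sum>b\<in>B. (X u \<bullet> b) *\<^sub>R b)" if "finite B" for B
    using that
  proof (induction B rule: finite_induct)
    case empty
    show ?case
      using nabla_const_position[OF u, of 0] by simp
  next
    case (insert b B)
    have "smooth_on \<Omega> (\<lambda>w. \<Sum>b\<in>B. (X w \<bullet> b) *\<^sub>R b)"
      by (intro smooth_on_sum smooth_on_scaleR smooth_on_inner_const open_\<Omega> X smooth_on_const insert)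
    then have "nabla (\<lambda>w. (X w \<bullet> b) *\<^sub>R b + 1 *\<^sub>R (\<Sum>b\<in>B. (X w \<bullet> b) *\<^sub>R b)) ?E u
        = (X u \<bullet> b) *\<^sub>R nabla (\<lambda>_. b) ?E u + 1 *\<^sub>R nabla (\<lambda>w. \<Sum>b\<in>B. (X w \<bullet> b) *\<^sub>R b) ?E u"
      by (intro nabla_linear_left smooth_on_inner_const[OF open_\<Omega> X] smooth_on_const
          smooth_on_const_position(2) u)
    then show ?case
      using insert nabla_const_position[OF u] by simp
  qed
  from this[OF finite_Basis] show ?thesis
    by (simp add: euclidean_representation)
qed

text \<open>This gives the normal component of \<open>\<nabla>\<^sub>X Y\<close>: metric compatibility for
  \<open>Y\<close> and the position field \<open>E\<close>, in which \<open>\<nabla>\<^sub>X E =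
  X\<close>. When the first term on the right vanishes, as it does on a leaf, the second
  fundamental form is a multiple of the metric.\<close>

lemma metric_nabla_position:
  assumes X: "smooth_on \<Omega> X" and Y: "smooth_on \<Omega> Y" and u: "u \<in> \<Omega>"
  shows "hess \<Phi> u (nabla X Y u) u = frechet_derivative (\<lambda>w. d\<Phi> w (Y w)) (at u) (X u) - hess \<Phi> u (Y u) (X u)"
proof -
  have "frechet_derivative (\<lambda>w. hess \<Phi> w (Y w) w) (at u) = frechet_derivative (\<lambda>w. d\<Phi> w (Y w)) (at u)"
    by (intro frechet_derivative_cong_on[OF open_\<Omega> u] metric_position_right in_C)
  with metric_compatible[OF X Y smooth_on_const_position(2) u] nabla_position[OF X u]
  show ?thesis
    by simp
qed

text \<open>The Christoffel symbols vanish on a pair of radial vectors. Let \<open>x = r z\<close>, and let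
  \<open>v\<close> be constant. At \<open>z\<close>, the metric is constant in direction
  \<open>x\<close>, so \<open>G(\<nabla>\<^sub>x x, v) = - G(x, \<nabla>\<^sub>x v)\<close>, and
  the right-hand side is a multiple of \<open>G(z, \<nabla>\<^sub>x v)\<close>, which
  \<open>metric_nabla_position\<close> shows to be zero for constant \<open>v\<close>.\<close>

lemma nabla_radial_const:
  assumes z: "z \<in> \<Omega>"
  shows "nabla (\<lambda>_. r *\<^sub>R z) (\<lambda>_. r *\<^sub>R z) z = 0"
proof (rule metric_nondegenerate[OF in_C[OF z]])
  fix v :: 'a
  note lin = linear_cmul[OF metric_linear_right[OF in_C[OF z]]] linear_cmul[OF metric_linear_left[OF in_C[OF z]]]
  let ?x = "\<lambda>_::'a. r *\<^sub>R z" and ?v = "\<lambda>_::'a. v"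
  have "hess \<Phi> z (nabla ?x ?v z) z = 0"
    using metric_nabla_position[OF smooth_on_const smooth_on_const z, of "r *\<^sub>R z" v]
      metric_symmetric[OF in_C[OF z], of v "r *\<^sub>R z"]
    by (simp flip: hess_def)
  then have "hess \<Phi> z (r *\<^sub>R z) (nabla ?x ?v z) = 0"
    using lin metric_symmetric[OF in_C[OF z], of z] by simp
  moreover have "frechet_derivative (\<lambda>w. hess \<Phi> w (r *\<^sub>R z) v) (at z) (r *\<^sub>R z) = 0"
  proof -
    have "smooth_on C (\<lambda>w. hess \<Phi> w (r *\<^sub>R z) v)"
      unfolding hess_def by (intro smooth_on_frechet_derivative smooth)
    then have "linear (frechet_derivative (\<lambda>w. hess \<Phi> w (r *\<^sub>R z) v) (at z))"
      using smooth_on_imp_has_derivative in_C[OF z] has_derivative_linear by blast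
    then show ?thesis
      using metric_radially_constant[OF in_C[OF z]] by (simp add: linear_cmul)
  qed
  ultimately have "hess \<Phi> z (nabla ?x ?x z) v = 0"
    using metric_compatible[OF smooth_on_const smooth_on_const smooth_on_const z, of "r *\<^sub>R z" v "r *\<^sub>R z"]
    by simp
  then show "hess \<Phi> z (nabla ?x ?x z) v = hess \<Phi> z 0 v"
    using linear_0[OF metric_linear_left[OF in_C[OF z]]] by simp
qed

text \<open>Along \<open>\<sigma>\<close> the length \<open>\<rho>\<close> of the position vector has
  derivative 1, so the velocity \<open>\<sigma> / \<rho>\<close> is constant; the remaining term
  of the covariant derivative is \<open>nabla_radial_const\<close>.\<close>

lemma radial_geodesic:
  assumes I: "open I" and \<sigma>_in: "\<And>t. t \<in> I \<Longrightarrow> \<sigma> t \<in> \<Omega>"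
    and \<sigma>: "\<And>t. t \<in> I \<Longrightarrow> (\<sigma> has_vector_derivative (1 / sqrt (2 * \<Phi> (\<sigma> t))) *\<^sub>R \<sigma> t) (at t)"
  shows "is_geodesic nabla I \<sigma>"
  unfolding is_geodesic_def
proof (intro ballI conjI)
  fix t
  assume t: "t \<in> I"
  define \<rho> where "\<rho> s = sqrt (2 * \<Phi> (\<sigma> s))" for s
  have pos: "\<Phi> (\<sigma> t) > 0"
    using potential_pos[OF in_C[OF \<sigma>_in[OF t]]] .
  then have \<rho>: "\<rho> t > 0" "(\<rho> t)\<^sup>2 = 2 * \<Phi> (\<sigma> t)"
    by (simp_all add: \<rho>_def)
  show "\<sigma> differentiable at t"
    using \<sigma>[OF t] differentiableI_vector by blast
  have eq: "vector_derivative \<sigma> (at s) = (1 / \<rho> s) *\<^sub>R \<sigma> s" if "s \<in> I" for s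
    using \<sigma>[OF that] by (simp add: \<rho>_def vector_derivative_at)
  have "((\<lambda>s. \<Phi> (\<sigma> s)) has_derivative (\<lambda>h. d\<Phi> (\<sigma> t) (h *\<^sub>R (1 / \<rho> t) *\<^sub>R \<sigma> t))) (at t)"
    using \<sigma>[OF t] has_derivative_potential[OF in_C[OF \<sigma>_in[OF t]]]
    unfolding has_vector_derivative_def \<rho>_def by (rule has_derivative_compose)
  moreover have "d\<Phi> (\<sigma> t) (h *\<^sub>R (1 / \<rho> t) *\<^sub>R \<sigma> t) = \<rho> t * h" for h
  proof -
    have "d\<Phi> (\<sigma> t) (h *\<^sub>R (1 / \<rho> t) *\<^sub>R \<sigma> t) = h * (1 / \<rho> t) * (\<rho> t)\<^sup>2"
      by (simp add: linear_cmul[OF linear_d[OF in_C[OF \<sigma>_in[OF t]]]] euler_potential in_C \<sigma>_in t \<rho>(2))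
    then show ?thesis
      using \<rho>(1) by (simp add: power2_eq_square)
  qed
  ultimately have d\<Phi>: "((\<lambda>s. \<Phi> (\<sigma> s)) has_field_derivative \<rho> t) (at t)"
    by (simp add: has_field_derivative_def)
  have d\<rho>: "((\<lambda>s. 1 / \<rho> s) has_field_derivative - 1 / (\<rho> t)\<^sup>2) (at t)"
    unfolding \<rho>_def
    by (rule derivative_eq_intros d\<Phi> refl | use pos in \<open>simp add: \<rho>_def power2_eq_square field_simps\<close>)+
  have "((\<lambda>s. (1 / \<rho> s) *\<^sub>R \<sigma> s) has_vector_derivative
      (1 / \<rho> t) *\<^sub>R (1 / \<rho> t) *\<^sub>R \<sigma> t + (- 1 / (\<rho> t)\<^sup>2) *\<^sub>R \<sigma> t) (at t)"
    using has_vector_derivative_scaleR[OF d\<rho> \<sigma>[OF t]] by (simp add: \<rho>_def)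
  then have "((\<lambda>s. (1 / \<rho> s) *\<^sub>R \<sigma> s) has_vector_derivative 0) (at t)"
    by (simp add: power2_eq_square)
  then have d2: "((\<lambda>s. vector_derivative \<sigma> (at s)) has_vector_derivative 0) (at t)"
    by (rule has_vector_derivative_transform_within_open[OF _ I t]) (simp add: eq)
  then show "(\<lambda>s. vector_derivative \<sigma> (at s)) differentiable at t"
    by (rule differentiableI_vector)
  show "covariant_derivative_along nabla \<sigma> (\<lambda>s. vector_derivative \<sigma> (at s)) t = 0"
    using nabla_radial_const[OF \<sigma>_in[OF t]]
    by (simp add: covariant_derivative_along_def vector_derivative_at[OF d2] eq[OF t])
qed

end

section \<open>Charts and the components of tangent and cotangent vectors\<close>

lemma cinv_cmap:
  assumes "smooth_manifold T A" "c \<in> A" "x \<in> cdom c"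
  shows "cinv c (cmap c x) = x"
proof -
  have "homeomorphic_map (subtopology T (cdom c)) (top_of_set (cmap c ` cdom c)) (cmap c)" "openin T (cdom c)"
    using assms(1,2) by (auto simp: smooth_manifold_def)
  then have "inj_on (cmap c) (cdom c)"
    using homeomorphic_imp_injective_map openin_subset
    by (metis inf.absorb2 topspace_subtopology)
  then show ?thesis
    using assms(3) by (simp add: cinv_def)
qed

lemma open_chart_image:
  assumes "smooth_manifold T A" "c \<in> A" "openin T U" "U \<subseteq> cdom c"
  shows "open (cmap c ` U)"
proof -
  have c: "homeomorphic_map (subtopology T (cdom c)) (top_of_set (cmap c ` cdom c)) (cmap c)"
    "open (cmap c ` cdom c)"
    using assms(1,2) by (auto simp: smooth_manifold_def)
  have "openin (subtopology T (cdom c)) U"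
    using assms(3,4) by (simp add: openin_subtopology) blast
  then have "openin (top_of_set (cmap c ` cdom c)) (cmap c ` U)"
    using homeomorphic_imp_open_map[OF c(1)] by (simp add: open_map_def)
  then show ?thesis
    using c(2) by (rule openin_open_trans)
qed

lemma openin_chart_domain: "smooth_manifold T A \<Longrightarrow> c \<in> A \<Longrightarrow> openin T (cdom c)"
  by (simp add: smooth_manifold_def)

lemma transition_has_derivative:
  assumes man: "smooth_manifold T A" and c: "c \<in> A" and d: "d \<in> A" and a: "a \<in> cdom c" "a \<in> cdom d"
  shows "((cmap d \<circ> cinv c) has_derivative frechet_derivative (cmap d \<circ> cinv c) (at (cmap c a))) (at (cmap c a))"
  by (rule smooth_on_imp_has_derivative[of "cmap c ` (cdom c \<inter> cdom d)"])
     (use assms in \<open>auto simp: smooth_manifold_def\<close>)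

text \<open>The chain rule for coordinate changes. It makes the component families \<open>tvec\<close> and
  \<open>tcovec\<close> obey the transformation laws, so that they really are tangent and
  cotangent vectors.\<close>

lemma trans_jac_chain:
  assumes man: "smooth_manifold T A" and A: "c \<in> A" "d \<in> A" "e \<in> A"
    and a: "a \<in> cdom c" "a \<in> cdom d" "a \<in> cdom e"
  shows "trans_jac c e a = trans_jac d e a ** trans_jac c d a"
proof -
  let ?W = "cmap c ` (cdom c \<inter> cdom d \<inter> cdom e)"
  let ?f = "cmap d \<circ> cinv c" and ?g = "cmap e \<circ> cinv d"
  have W: "open ?W" "cmap c a \<in> ?W"
    using a by (intro open_chart_image[OF man A(1)] openin_Int openin_chart_domain[OF man] A imageI; blast)+
  have fa: "?f (cmap c a) = cmap d a"
    using cinv_cmap[OF man A(1) a(1)] by simp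
  have f: "(?f has_derivative frechet_derivative ?f (at (cmap c a))) (at (cmap c a))"
    by (rule transition_has_derivative[OF man A(1,2) a(1,2)])
  have g: "(?g has_derivative frechet_derivative ?g (at (cmap d a))) (at (?f (cmap c a)))"
    unfolding fa by (rule transition_has_derivative[OF man A(2,3) a(2,3)])
  have "((\<lambda>x. ?g (?f x)) has_derivative
      (\<lambda>v. frechet_derivative ?g (at (cmap d a)) (frechet_derivative ?f (at (cmap c a)) v))) (at (cmap c a))"
    using f g by (rule has_derivative_compose)
  then have "((cmap e \<circ> cinv c) has_derivative
      (\<lambda>v. frechet_derivative ?g (at (cmap d a)) (frechet_derivative ?f (at (cmap c a)) v))) (at (cmap c a))"
    using W
    by (rule has_derivative_transform_within_open)
       (use cinv_cmap[OF man A(1)] cinv_cmap[OF man A(2)] in auto)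
  from frechet_derivative_at[OF this]
  have "frechet_derivative (cmap e \<circ> cinv c) (at (cmap c a))
      = frechet_derivative ?g (at (cmap d a)) \<circ> frechet_derivative ?f (at (cmap c a))"
    by (simp add: o_def)
  moreover have "linear (frechet_derivative ?f (at (cmap c a)))" "linear (frechet_derivative ?g (at (cmap d a)))"
    using has_derivative_linear[OF f] has_derivative_linear[OF g] by simp_all
  ultimately show ?thesis
    unfolding trans_jac_def jacobian_def by (simp add: matrix_compose)
qed

lemma trans_jac_self:
  assumes man: "smooth_manifold T A" and c: "c \<in> A" "a \<in> cdom c"
  shows "trans_jac c c a = mat 1"
proof -
  have "open (cmap c ` cdom c)"
    using open_chart_image[OF man c(1) openin_chart_domain[OF man c(1)]] by simp
  then have "frechet_derivative (cmap c \<circ> cinv c) (at (cmap c a)) = frechet_derivative (\<lambda>x. x) (at (cmap c a))"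
    using c(2) by (rule frechet_derivative_cong_on[OF _ imageI]) (use cinv_cmap[OF man c(1)] in auto)
  then show ?thesis
    unfolding trans_jac_def jacobian_def by (simp add: matrix_id_mat_1[unfolded id_def])
qed

lemma tvec_in_tangent_space:
  assumes man: "smooth_manifold T A" and c: "c \<in> A" "a \<in> cdom c"
  shows "tvec A c a y \<in> tangent_space A a"
proof -
  have chain: "trans_jac c e a *v y = trans_jac d e a *v (trans_jac c d a *v y)"
    if "d \<in> A" "e \<in> A" "a \<in> cdom d" "a \<in> cdom e" for d e
    by (subst trans_jac_chain[OF man c(1) that(1,2) c(2) that(3,4)]) (simp add: matrix_vector_mul_assoc)
  show ?thesis
    unfolding tangent_space_def tvec_def by (auto intro: chain)
qed

lemma tcovec_in_cotangent_space:
  assumes man: "smooth_manifold T A" and c: "c \<in> A" "a \<in> cdom c"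
  shows "tcovec A c a q \<in> cotangent_space A a"
proof -
  have chain: "transpose (trans_jac d c a) *v q = transpose (trans_jac d e a) *v (transpose (trans_jac e c a) *v q)"
    if "d \<in> A" "e \<in> A" "a \<in> cdom d" "a \<in> cdom e" for d e
    by (subst trans_jac_chain[OF man that(1,2) c(1) that(3,4) c(2)])
       (simp only: matrix_vector_mul_assoc matrix_transpose_mul)
  show ?thesis
    unfolding cotangent_space_def tcovec_def by (auto simp del: transpose_matrix_vector intro: chain)
qed

lemma tvec_self:
  "smooth_manifold T A \<Longrightarrow> c \<in> A \<Longrightarrow> a \<in> cdom c \<Longrightarrow> tvec A c a y c = y"
  by (simp add: tvec_def trans_jac_self)

lemma tcovec_self:
  "smooth_manifold T A \<Longrightarrow> c \<in> A \<Longrightarrow> a \<in> cdom c \<Longrightarrow> tcovec A c a q c = q"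
  by (simp add: tcovec_def trans_jac_self transpose_mat)

lemma tvec_components:
  assumes "v \<in> tangent_space A a" "c \<in> A" "a \<in> cdom c"
  shows "tvec A c a (v c) = v"
proof
  fix d
  have "v d = trans_jac c d a *v v c" if "d \<in> A" "a \<in> cdom d"
    using assms that unfolding tangent_space_def by blast
  moreover have "v d = 0" if "\<not> (d \<in> A \<and> a \<in> cdom d)"
    using assms(1) that unfolding tangent_space_def by blast
  ultimately show "tvec A c a (v c) d = v d"
    by (simp add: tvec_def)
qed

lemma tcovec_components:
  assumes "p \<in> cotangent_space A a" "c \<in> A" "a \<in> cdom c"
  shows "tcovec A c a (p c) = p"
proof
  fix d
  have "p d = transpose (trans_jac d c a) *v p c" if "d \<in> A" "a \<in> cdom d"
    using assms that unfolding cotangent_space_def by blast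
  moreover have "p d = 0" if "\<not> (d \<in> A \<and> a \<in> cdom d)"
    using assms(1) that unfolding cotangent_space_def by blast
  ultimately show "tcovec A c a (p c) d = p d"
    by (simp add: tcovec_def)
qed

lemma tvec_scaleR: "tvec A c a (r *\<^sub>R y) = (\<lambda>d. r *\<^sub>R tvec A c a y d)"
  by (rule ext) (simp add: tvec_def matrix_vector_mult_scaleR)

lemma tcovec_scaleR: "tcovec A c a (r *\<^sub>R q) = (\<lambda>d. r *\<^sub>R tcovec A c a q d)"
  by (rule ext) (simp add: tcovec_def matrix_vector_mult_scaleR del: transpose_matrix_vector)

section \<open>The vertical metric as a Hessian\<close>

lemma half_hessian_hess:
  assumes "open S" "smooth_on S f" "y \<in> S"
  shows "v \<bullet> (half_hessian f y *v w) = hess f y v w / 2"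
proof -
  have l: "linear (\<lambda>v. hess f y v w)" and r: "linear (\<lambda>w. hess f y v w)" for v w
    using hess_linear_left[OF assms(2,3)] hess_linear_right[OF assms] .
  have exp: "x = (\<Sum>i\<in>UNIV. x $ i *\<^sub>R axis i 1)" for x :: "real ^ 'a"
    using basis_expansion[of x] by (simp add: scalar_mult_eq_scaleR)
  have "hess f y v w = (\<Sum>i\<in>UNIV. v $ i * hess f y (axis i 1) w)"
    by (subst exp[of v]) (simp add: linear_sum[OF l] linear_cmul[OF l])
  also have "\<dots> = (\<Sum>i\<in>UNIV. v $ i * (\<Sum>j\<in>UNIV. w $ j * hess f y (axis i 1) (axis j 1)))"
    by (subst exp[of w]) (simp add: linear_sum[OF r] linear_cmul[OF r])
  finally show ?thesis
    by (simp add: inner_vec_def matrix_vector_mult_def half_hessian_def hess_def sum_distrib_left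
        sum_divide_distrib mult_ac)
qed

definition nonzero_fibre :: "('n::finite) fibre set" where
  "nonzero_fibre = (- {0}) \<times> (- {0})"

definition fibre_potential ::
    "('m, 'n::finite) chart set \<Rightarrow> ('m \<Rightarrow> ('m, 'n) components \<Rightarrow> real) \<Rightarrow>
     ('m \<Rightarrow> ('m, 'n) components \<Rightarrow> real) \<Rightarrow> ('m, 'n) chart \<Rightarrow> 'm \<Rightarrow> 'n fibre \<Rightarrow> real" where
  "fibre_potential A F K c a = (\<lambda>(y, q). ((F a (tvec A c a y))\<^sup>2 + (K a (tcovec A c a q))\<^sup>2) / 2)"

lemma open_nonzero_fibre: "open nonzero_fibre"
  unfolding nonzero_fibre_def by (intro open_Times) auto

lemma smooth_on_separated_sum:
  fixes f :: "'a::real_normed_vector \<Rightarrow> real" and h :: "'b::real_normed_vector \<Rightarrow> real"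
  assumes S: "open S" "smooth_on S f" and U: "open U" "smooth_on U h"
  shows "smooth_on (S \<times> U) (\<lambda>z. (f (fst z) + h (snd z)) / 2)"
proof -
  have o: "open (S \<times> U)"
    using S(1) U(1) by (rule open_Times)
  have "smooth_on (S \<times> U) (\<lambda>z. f (fst z))"
    using smooth_on_affine[OF bounded_linear_fst o _ S(2), of 0] by auto
  moreover have "smooth_on (S \<times> U) (\<lambda>z. h (snd z))"
    using smooth_on_affine[OF bounded_linear_snd o _ U(2), of 0] by auto
  ultimately have "smooth_on (S \<times> U) (\<lambda>z. (1/2) *\<^sub>R (f (fst z) + h (snd z)))"
    by (intro smooth_on_scaleR[OF o] smooth_on_add[OF o] smooth_on_const)
  then show ?thesis
    by simp
qed

lemma hess_separated_sum:
  fixes f :: "'a::real_normed_vector \<Rightarrow> real" and h :: "'b::real_normed_vector \<Rightarrow> real"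
  assumes S: "open S" "smooth_on S f" and U: "open U" "smooth_on U h" and z: "z \<in> S \<times> U"
  shows "hess (\<lambda>z. (f (fst z) + h (snd z)) / 2) z v w
    = (hess f (fst z) (fst v) (fst w) + hess h (snd z) (snd v) (snd w)) / 2"
proof -
  let ?\<Phi> = "\<lambda>z. (f (fst z) + h (snd z)) / 2"
  have D: "frechet_derivative ?\<Phi> (at x)
      = (\<lambda>w. (frechet_derivative f (at (fst x)) (fst w) + frechet_derivative h (at (snd x)) (snd w)) / 2)"
    if "x \<in> S \<times> U" for x
  proof -
    have "(f has_derivative frechet_derivative f (at (fst x))) (at (fst x))"
      "(h has_derivative frechet_derivative h (at (snd x))) (at (snd x))"
      using that S U by (auto intro: smooth_on_imp_has_derivative)
    from has_derivative_compose[OF bounded_linear_imp_has_derivative[OF bounded_linear_fst] this(1)]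
      has_derivative_compose[OF bounded_linear_imp_has_derivative[OF bounded_linear_snd] this(2)]
    show ?thesis
      by (intro frechet_derivative_at[symmetric] bounded_linear.has_derivative[OF bounded_linear_divide] has_derivative_add) auto
  qed
  have "frechet_derivative (\<lambda>x. frechet_derivative ?\<Phi> (at x) w) (at z)
      = frechet_derivative (\<lambda>x. (frechet_derivative f (at (fst x)) (fst w)
          + frechet_derivative h (at (snd x)) (snd w)) / 2) (at z)"
    using D by (intro frechet_derivative_cong_on[OF open_Times[OF S(1) U(1)] z]) simp
  also have "\<dots> = (\<lambda>v. (hess f (fst z) (fst v) (fst w) + hess h (snd z) (snd v) (snd w)) / 2)"
  proof -
    have "((\<lambda>x. frechet_derivative f (at x) (fst w)) has_derivative (\<lambda>v. hess f (fst z) v (fst w))) (at (fst z))"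
      "((\<lambda>x. frechet_derivative h (at x) (snd w)) has_derivative (\<lambda>v. hess h (snd z) v (snd w))) (at (snd z))"
      using z S U by (auto intro: has_derivative_hess)
    from has_derivative_compose[OF bounded_linear_imp_has_derivative[OF bounded_linear_fst] this(1)]
      has_derivative_compose[OF bounded_linear_imp_has_derivative[OF bounded_linear_snd] this(2)]
    show ?thesis
      by (intro frechet_derivative_at[symmetric] bounded_linear.has_derivative[OF bounded_linear_divide] has_derivative_add) auto
  qed
  finally show ?thesis
    by (simp add: hess_def)
qed

text \<open>This allows \<open>vertical_metric\<close>, which is a Hessian where \<open>y\<close> and
  \<open>p\<close> are nonzero, to be replaced by the Hessian of the potential on a leaf.\<close>

lemma levi_civita_cong:
  assumes "open \<Omega>" and "\<And>z. z \<in> \<Omega> \<Longrightarrow> G z = G' z" and "levi_civita \<Omega> G nabla"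
  shows "levi_civita \<Omega> G' nabla"
proof -
  have "frechet_derivative (\<lambda>w. G w (Y w) (Z w)) (at u) = frechet_derivative (\<lambda>w. G' w (Y w) (Z w)) (at u)"
    if "u \<in> \<Omega>" for Y Z u
    using assms(2) by (intro frechet_derivative_cong_on[OF assms(1) that]) simp
  with assms(2,3) show ?thesis
    unfolding levi_civita_def by simp
qed

text \<open>One fibre of the big-tangent manifold, in the coordinates of one chart. Tangent curves may use
  different charts at different times, so these results are instantiated with varying
  \<open>c\<close> and \<open>a\<close>.\<close>

locale finsler_fibre =
  fixes T :: "'m topology" and A :: "('m, 'n::finite) chart set"
    and F K :: "'m \<Rightarrow> ('m, 'n) components \<Rightarrow> real"
    and c :: "('m, 'n) chart" and a :: 'm
  assumes manifold: "smooth_manifold T A"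
    and finsler: "finsler_structure A F" and cartan: "cartan_structure A K"
    and chart: "c \<in> A" and base: "a \<in> cdom c"
begin

abbreviation f where "f y \<equiv> (F a (tvec A c a y))\<^sup>2"
abbreviation h where "h q \<equiv> (K a (tcovec A c a q))\<^sup>2"

lemma smooth_f: "smooth_on (- {0}) f"
proof -
  have *: "open (- {0::real ^ 'n})" by (simp add: open_Compl)
  have "bounded_linear (\<lambda>y::real ^ 'n. (0::real ^ 'n, y))"
    by (intro bounded_linear_Pair bounded_linear_zero bounded_linear_ident)
  moreover have "smooth_on (cmap c ` cdom c \<times> (- {0}))
        (\<lambda>(x, y). F (cinv c x) (tvec A c (cinv c x) y))"
    using finsler chart by (simp add: finsler_structure_def)
  ultimately have "smooth_on (- {0}) (\<lambda>y. case (cmap c a, 0) + (0, y) of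
      (x, y) \<Rightarrow> F (cinv c x) (tvec A c (cinv c x) y))"
    using base by (intro smooth_on_affine[OF _ *, of _ "(cmap c a, 0)"]) auto
  then have "smooth_on (- {0}) (\<lambda>y. F a (tvec A c a y))"
    by (simp add: cinv_cmap[OF manifold chart base])
  from smooth_on_scaleR[OF * this this] show ?thesis
    by (simp add: power2_eq_square)
qed

lemma smooth_h: "smooth_on (- {0}) h"
proof -
  have *: "open (- {0::real ^ 'n})" by (simp add: open_Compl)
  have "bounded_linear (\<lambda>y::real ^ 'n. (0::real ^ 'n, y))"
    by (intro bounded_linear_Pair bounded_linear_zero bounded_linear_ident)
  moreover have "smooth_on (cmap c ` cdom c \<times> (- {0}))
        (\<lambda>(x, q). K (cinv c x) (tcovec A c (cinv c x) q))"
    using cartan chart by (simp add: cartan_structure_def)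
  ultimately have "smooth_on (- {0}) (\<lambda>q. case (cmap c a, 0) + (0, q) of
      (x, q) \<Rightarrow> K (cinv c x) (tcovec A c (cinv c x) q))"
    using base by (intro smooth_on_affine[OF _ *, of _ "(cmap c a, 0)"]) auto
  then have "smooth_on (- {0}) (\<lambda>q. K a (tcovec A c a q))"
    by (simp add: cinv_cmap[OF manifold chart base])
  from smooth_on_scaleR[OF * this this] show ?thesis
    by (simp add: power2_eq_square)
qed

abbreviation \<Phi> :: "'n fibre \<Rightarrow> real" where "\<Phi> \<equiv> fibre_potential A F K c a"

lemma potential_separated: "\<Phi> = (\<lambda>z. (f (fst z) + h (snd z)) / 2)"
  by (auto simp: fibre_potential_def)

lemma vertical_metric_hess:
  assumes "z \<in> nonzero_fibre"
  shows "vertical_metric A F K c a z = hess \<Phi> z"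
proof (intro ext)
  fix X Y :: "'n fibre"
  have z: "z \<in> (- {0}) \<times> (- {0})" "fst z \<in> - {0}" "snd z \<in> - {0}"
    using assms by (auto simp: nonzero_fibre_def)
  have "vertical_metric A F K c a z X Y
      = fst X \<bullet> (half_hessian f (fst z) *v fst Y) + snd X \<bullet> (half_hessian h (snd z) *v snd Y)"
    by (simp add: vertical_metric_def finsler_g_def cartan_g_def case_prod_unfold)
  also have "\<dots> = (hess f (fst z) (fst X) (fst Y) + hess h (snd z) (snd X) (snd Y)) / 2"
    by (simp only: half_hessian_hess[OF open_Compl[OF closed_singleton] smooth_f z(2)]
      half_hessian_hess[OF open_Compl[OF closed_singleton] smooth_h z(3)] add_divide_distrib)
  also have "\<dots> = hess \<Phi> z X Y"
    unfolding potential_separated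
    by (rule hess_separated_sum[symmetric, OF _ smooth_f _ smooth_h z(1)]) (simp_all add: open_Compl)
  finally show "vertical_metric A F K c a z X Y = hess \<Phi> z X Y" .
qed

lemma potential_homogeneous:
  assumes "r > 0"
  shows "\<Phi> (r *\<^sub>R z) = r\<^sup>2 * \<Phi> z"
proof -
  have a: "a \<in> \<Union> (cdom ` A)"
    using chart base by blast
  have "F a (tvec A c a (r *\<^sub>R y)) = r * F a (tvec A c a y)" for y
    using finsler a tvec_in_tangent_space[OF manifold chart base, of y] assms
    unfolding finsler_structure_def tvec_scaleR by blast
  moreover have "K a (tcovec A c a (r *\<^sub>R q)) = r * K a (tcovec A c a q)" for q
    using cartan a tcovec_in_cotangent_space[OF manifold chart base, of q] assms
    unfolding cartan_structure_def tcovec_scaleR by blast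
  ultimately show ?thesis
    by (simp add: potential_separated power_mult_distrib algebra_simps)
qed

lemma vertical_metric_pos:
  assumes z: "z \<in> nonzero_fibre" and w: "w \<noteq> 0"
  shows "vertical_metric A F K c a z w w > 0"
proof -
  have "fst z \<noteq> 0" "snd z \<noteq> 0"
    using z by (auto simp: nonzero_fibre_def)
  then have 1: "x \<noteq> 0 \<Longrightarrow> 0 < x \<bullet> (finsler_g A F c a (fst z) *v x)"
    and 2: "x \<noteq> 0 \<Longrightarrow> 0 < x \<bullet> (cartan_g A K c a (snd z) *v x)" for x
    using finsler cartan chart base unfolding finsler_structure_def cartan_structure_def by blast+
  from w have "fst w \<noteq> 0 \<or> snd w \<noteq> 0"
    by (auto simp: prod_eq_iff)
  then show ?thesis
    using 1[of "fst w"] 2[of "snd w"]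
    by (cases "fst w = 0"; cases "snd w = 0") (auto simp: vertical_metric_def case_prod_unfold)
qed

sublocale homogeneous_potential "nonzero_fibre :: 'n fibre set" \<Phi>
proof
  show "open (nonzero_fibre :: 'n fibre set)"
    by (rule open_nonzero_fibre)
  show "r *\<^sub>R z \<in> nonzero_fibre" if "z \<in> nonzero_fibre" "r > 0" for r and z :: "'n fibre"
    using that by (auto simp: nonzero_fibre_def)
  show "(0 :: 'n fibre) \<notin> nonzero_fibre"
    by (simp add: nonzero_fibre_def zero_prod_def)
  show "smooth_on nonzero_fibre \<Phi>"
    unfolding potential_separated nonzero_fibre_def
    by (rule smooth_on_separated_sum[OF _ smooth_f _ smooth_h]) (simp_all add: open_Compl)
  show "\<Phi> (r *\<^sub>R z) = r\<^sup>2 * \<Phi> z" if "r > 0" for r z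
    using that by (rule potential_homogeneous)
  show "hess \<Phi> z w w > 0" if "z \<in> nonzero_fibre" "w \<noteq> 0" for z w
    using vertical_metric_pos[OF that] vertical_metric_hess[OF that(1)] by simp
qed

definition lift :: "'n fibre \<Rightarrow> ('m, 'n) big_tangent" where
  "lift z = (a, tvec A c a (fst z), tcovec A c a (snd z))"

lemma lift_in_big_tangent0:
  assumes "z \<in> nonzero_fibre"
  shows "lift z \<in> big_tangent0 A"
proof -
  have "tvec A c a (fst z) \<noteq> (\<lambda>_. 0)" "tcovec A c a (snd z) \<noteq> (\<lambda>_. 0)"
    using assms tvec_self[OF manifold chart base, of "fst z"] tcovec_self[OF manifold chart base, of "snd z"]
    unfolding nonzero_fibre_def by (metis ComplD mem_Times_iff singletonI)+
  then show ?thesis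
    using tvec_in_tangent_space[OF manifold chart base] tcovec_in_cotangent_space[OF manifold chart base]
      chart base by (auto simp: lift_def big_tangent0_def)
qed

lemma fst_lift: "fst (lift z) = a"
  by (simp add: lift_def)

lemma fibre_coords_lift: "fibre_coords c (lift z) = z"
  by (simp add: lift_def fibre_coords_def tvec_self[OF manifold chart base] tcovec_self[OF manifold chart base])

lemma bt_coords_lift: "bt_coords c (lift z) = (cmap c a, z)"
  by (simp add: lift_def bt_coords_def tvec_self[OF manifold chart base] tcovec_self[OF manifold chart base])

lemma lift_fibre_coords:
  assumes "u \<in> big_tangent0 A" "fst u = a"
  shows "lift (fibre_coords c u) = u"
  using assms
  by (auto simp: lift_def fibre_coords_def big_tangent0_def
      tvec_components[OF _ chart base] tcovec_components[OF _ chart base])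

lemma fibre_coords_nonzero:
  assumes "u \<in> big_tangent0 A" "fst u = a"
  shows "fibre_coords c u \<in> nonzero_fibre"
proof -
  have [simp]: "tvec A c a 0 = (\<lambda>_. 0)" "tcovec A c a 0 = (\<lambda>_. 0)"
    by (auto simp: tvec_def tcovec_def)
  show ?thesis
    using lift_fibre_coords[OF assms] assms(1)
    by (auto simp: nonzero_fibre_def lift_def big_tangent0_def mem_Times_iff)
qed

lemma energy_fibre_potential:
  assumes "(a, v, p) \<in> big_tangent0 A"
  shows "(F a v)\<^sup>2 + (K a p)\<^sup>2 = 2 * \<Phi> (fibre_coords c (a, v, p))"
  using assms
  by (auto simp: fibre_potential_def fibre_coords_def big_tangent0_def
      tvec_components[OF _ chart base] tcovec_components[OF _ chart base])

lemma liouville_norm_potential: "liouville_norm A F K c a z = sqrt (2 * \<Phi> z)"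
  by (simp add: liouville_norm_def fibre_potential_def case_prod_unfold)

text \<open>Orthogonality to the Liouville field is tangency to the level sets of the potential.\<close>

lemma liouville_orthogonal_iff:
  "z \<in> nonzero_fibre \<Longrightarrow> vertical_metric A F K c a z w (liouville z) = d\<Phi> z w"
  using metric_position_right by (simp add: vertical_metric_hess liouville_def case_prod_unfold)

lemma tangent_curve_lift:
  assumes "continuous_on {0..1} \<zeta>'"
    and "\<And>s. s \<in> {0..1} \<Longrightarrow> \<zeta> s \<in> nonzero_fibre"
    and "\<And>s. s \<in> {0..1} \<Longrightarrow> (\<zeta> has_vector_derivative \<zeta>' s) (at s within {0..1})"
    and "\<And>s. s \<in> {0..1} \<Longrightarrow> (0, \<zeta>' s) \<in> D c (lift (\<zeta> s))"
  shows "tangent_curve A D (lift \<circ> \<zeta>)"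
  unfolding tangent_curve_def
proof (intro conjI ballI)
  show "(lift \<circ> \<zeta>) ` {0..1} \<subseteq> big_tangent0 A"
    unfolding image_subset_iff comp_apply by (intro ballI lift_in_big_tangent0 assms(2))
  fix t :: real
  assume "t \<in> {0..1}"
  have "((bt_coords c \<circ> (lift \<circ> \<zeta>)) has_vector_derivative (0, \<zeta>' s)) (at s within {0..1})"
    if "s \<in> {0..1}" for s
    unfolding o_def bt_coords_lift
    by (intro has_vector_derivative_Pair has_vector_derivative_const assms(3) that)
  then show "\<exists>c\<in>A. \<exists>U. \<exists>\<gamma>'. open U \<and> t \<in> U \<and> continuous_on (U \<inter> {0..1}) \<gamma>' \<and>
        (\<forall>s\<in>U \<inter> {0..1}. fst ((lift \<circ> \<zeta>) s) \<in> cdom c \<and>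
           ((bt_coords c \<circ> (lift \<circ> \<zeta>)) has_vector_derivative \<gamma>' s) (at s within {0..1}) \<and>
           \<gamma>' s \<in> D c ((lift \<circ> \<zeta>) s))"
    using chart base assms(1,4)
    by (intro bexI[of _ c] exI[of _ UNIV] exI[of _ "\<lambda>s. (0, \<zeta>' s)"])
       (auto simp: fst_lift intro!: continuous_intros)
qed

end

section \<open>Leaves of the vertical and the vertical Liouville foliation\<close>

lemma leaf_subset_big_tangent0:
  assumes "is_leaf A D L"
  shows "L \<subseteq> big_tangent0 A"
proof
  fix w
  assume "w \<in> L"
  with assms obtain u where "u \<in> big_tangent0 A" "(u, w) \<in> {(\<gamma> 0, \<gamma> 1) | \<gamma>. tangent_curve A D \<gamma>}\<^sup>*"
    by (auto simp: is_leaf_def leaf_through_def)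
  from this(2,1) show "w \<in> big_tangent0 A"
    by (induction rule: rtrancl_induct) (auto simp: tangent_curve_def)
qed

lemma leaf_closed_under_tangent_curves:
  assumes "is_leaf A D L" "tangent_curve A D \<gamma>" "\<gamma> 0 \<in> L"
  shows "\<gamma> 1 \<in> L"
  using assms by (auto simp: is_leaf_def leaf_through_def intro: rtrancl_into_rtrancl)

text \<open>Near each time one chart \<open>c\<close> serves. There the velocity has no component along the
  base, so the base point stays at some \<open>b\<close>; then \<open>F\<^sup>2 +
  K\<^sup>2\<close> is twice the potential of the fibre over \<open>b\<close> in the coordinates
  of \<open>c\<close>, whose derivative kills the velocity. Hence \<open>F\<^sup>2 +
  K\<^sup>2\<close> has derivative 0 on the whole interval.\<close>

lemma energy_constant_along_tangent_curve:
  assumes man: "smooth_manifold T A" and F: "finsler_structure A F" and K: "cartan_structure A K"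
    and \<gamma>: "tangent_curve A (vertical_liouville A F K) \<gamma>"
  defines "\<Psi> \<equiv> \<lambda>(b, v, p). (F b v)\<^sup>2 + (K b p)\<^sup>2"
  shows "\<Psi> (\<gamma> 1) = \<Psi> (\<gamma> 0)"
proof -
  have "((\<lambda>s. \<Psi> (\<gamma> s)) has_vector_derivative 0) (at t within {0..1})" if t: "t \<in> {0..1}" for t
  proof -
    obtain c U \<gamma>' where c: "c \<in> A" and U: "open U" "t \<in> U"
      and \<gamma>': "\<And>s. s \<in> U \<inter> {0..1} \<Longrightarrow> fst (\<gamma> s) \<in> cdom c"
      "\<And>s. s \<in> U \<inter> {0..1} \<Longrightarrow> ((bt_coords c \<circ> \<gamma>) has_vector_derivative \<gamma>' s) (at s within {0..1})"
      "\<And>s. s \<in> U \<inter> {0..1} \<Longrightarrow> \<gamma>' s \<in> vertical_liouville A F K c (\<gamma> s)"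
      using \<gamma> t unfolding tangent_curve_def by metis
    have big: "\<gamma> s \<in> big_tangent0 A" if "s \<in> {0..1}" for s
      using \<gamma> that by (auto simp: tangent_curve_def)
    obtain e where e: "e > 0" "ball t e \<subseteq> U"
      using U open_contains_ball by blast
    define J where "J = ball t e \<inter> {0..1}"
    have J: "convex J" "t \<in> J" "J \<subseteq> U \<inter> {0..1}"
      using e t by (auto simp: J_def intro: convex_Int)
    have fst': "fst (bt_coords c (\<gamma> s)) = cmap c (fst (\<gamma> s))" for s
      by (simp add: bt_coords_def case_prod_unfold)
    have snd': "snd (bt_coords c (\<gamma> s)) = fibre_coords c (\<gamma> s)" for s
      by (simp add: bt_coords_def fibre_coords_def case_prod_unfold)
    have "((\<lambda>s. cmap c (fst (\<gamma> s))) has_vector_derivative 0) (at s within J)" if "s \<in> J" for s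
    proof -
      have s: "s \<in> U \<inter> {0..1}"
        using that J by blast
      have "((\<lambda>s. fst (bt_coords c (\<gamma> s))) has_vector_derivative fst (\<gamma>' s)) (at s within {0..1})"
        using bounded_linear.has_vector_derivative[OF bounded_linear_fst \<gamma>'(2)[OF s]] by simp
      moreover have "fst (\<gamma>' s) = 0"
        using \<gamma>'(3)[OF s] by (auto simp: vertical_liouville_def)
      ultimately show ?thesis
        unfolding fst' using J(3) by (auto intro: has_vector_derivative_within_subset)
    qed
    from has_vector_derivative_zero_constant[OF J(1) this]
    obtain x where x: "\<And>s. s \<in> J \<Longrightarrow> cmap c (fst (\<gamma> s)) = x"
      by blast
    define b where "b = fst (\<gamma> t)"
    have b: "fst (\<gamma> s) = b" if "s \<in> J" for s
      using x[OF that] x[OF J(2)] cinv_cmap[OF man c \<gamma>'(1)] J that unfolding b_def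
      by (metis (no_types, lifting) subsetD)
    interpret finsler_fibre T A F K c b
      using man F K c \<gamma>'(1)[of t] J(2,3) unfolding b_def by unfold_locales blast+
    have eq: "\<Psi> (\<gamma> s) = 2 * \<Phi> (fibre_coords c (\<gamma> s))" if "s \<in> J" for s
    proof -
      have "\<gamma> s = (b, fst (snd (\<gamma> s)), snd (snd (\<gamma> s)))"
        using b[OF that] by (simp add: prod_eq_iff)
      then obtain v p where "\<gamma> s = (b, v, p)"
        by blast
      moreover have "\<gamma> s \<in> big_tangent0 A"
        using that J by (intro big) auto
      ultimately show ?thesis
        using energy_fibre_potential by (simp add: \<Psi>_def)
    qed
    have tU: "t \<in> U \<inter> {0..1}"
      using J by blast
    have z: "fibre_coords c (\<gamma> t) \<in> nonzero_fibre"
      using fibre_coords_nonzero[OF big] t b_def by simp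
    have "((\<lambda>s. snd (bt_coords c (\<gamma> s))) has_vector_derivative snd (\<gamma>' t)) (at t within {0..1})"
      using bounded_linear.has_vector_derivative[OF bounded_linear_snd \<gamma>'(2)[OF tU]] by simp
    then have "((\<lambda>s. fibre_coords c (\<gamma> s)) has_derivative (\<lambda>h. h *\<^sub>R snd (\<gamma>' t))) (at t within {0..1})"
      by (simp add: snd' has_vector_derivative_def)
    from has_derivative_compose[OF this has_derivative_potential[OF z]]
    have "((\<lambda>s. \<Phi> (fibre_coords c (\<gamma> s))) has_derivative
        (\<lambda>h. d\<Phi> (fibre_coords c (\<gamma> t)) (h *\<^sub>R snd (\<gamma>' t)))) (at t within {0..1})" .
    moreover have "d\<Phi> (fibre_coords c (\<gamma> t)) (snd (\<gamma>' t)) = 0"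
      using \<gamma>'(3)[OF tU] liouville_orthogonal_iff[OF z]
      by (auto simp: vertical_liouville_def b_def)
    ultimately have "((\<lambda>s. \<Phi> (fibre_coords c (\<gamma> s))) has_derivative (\<lambda>h. 0)) (at t within {0..1})"
      using linear_cmul[OF linear_d[OF z]] by simp
    from has_derivative_mult_right[OF this, of 2]
    have "((\<lambda>s. 2 * \<Phi> (fibre_coords c (\<gamma> s))) has_derivative (\<lambda>h. 0)) (at t within {0..1})"
      by simp
    then have "((\<lambda>s. \<Psi> (\<gamma> s)) has_derivative (\<lambda>h. 0)) (at t within {0..1})"
      using e(1) t by (rule has_derivative_transform_within) (simp add: eq J_def dist_commute)
    then show ?thesis
      by (simp add: has_vector_derivative_def)
  qed
  from has_vector_derivative_zero_constant[OF convex_real_interval(5) this]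
  obtain k where "\<And>s. s \<in> {0..1} \<Longrightarrow> \<Psi> (\<gamma> s) = k"
    by blast
  from this[of 0] this[of 1] show ?thesis
    by simp
qed

lemma energy_constant_on_leaf:
  assumes man: "smooth_manifold T A" and F: "finsler_structure A F" and K: "cartan_structure A K"
    and L: "is_leaf A (vertical_liouville A F K) L"
  shows "\<exists>r. \<forall>(b, v, p)\<in>L. (F b v)\<^sup>2 + (K b p)\<^sup>2 = r"
proof -
  define \<Psi> where "\<Psi> = (\<lambda>(b, v, p). (F b v)\<^sup>2 + (K b p)\<^sup>2)"
  obtain u where u: "L = leaf_through A (vertical_liouville A F K) u"
    using L by (auto simp: is_leaf_def)
  have step: "\<Psi> (\<gamma> 1) = \<Psi> (\<gamma> 0)" if "tangent_curve A (vertical_liouville A F K) \<gamma>" for \<gamma>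
    unfolding \<Psi>_def using energy_constant_along_tangent_curve[OF man F K that] .
  have "\<Psi> w = \<Psi> u" if "w \<in> L" for w
  proof -
    have "(u, w) \<in> {(\<gamma> 0, \<gamma> 1) | \<gamma>. tangent_curve A (vertical_liouville A F K) \<gamma>}\<^sup>*"
      using that by (simp add: u leaf_through_def)
    then show ?thesis
    proof (induction rule: rtrancl_induct)
      case (step x y)
      then obtain \<gamma> where "tangent_curve A (vertical_liouville A F K) \<gamma>" "x = \<gamma> 0" "y = \<gamma> 1"
        by blast
      with step.IH \<open>\<And>\<gamma>. _ \<Longrightarrow> \<Psi> (\<gamma> 1) = \<Psi> (\<gamma> 0)\<close> show ?case
        by simp
    qed simp
  qed
  then show ?thesis
    by (intro exI[of _ "\<Psi> u"]) (auto simp: \<Psi>_def)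
qed

text \<open>A leaf of the vertical foliation is open in its fibre because straight segments in the fibre are
  tangent to \<open>V\<close>. It need not be the whole fibre: for \<open>n = 1\<close> the
  condition that \<open>y\<close> and \<open>p\<close> be nonzero disconnects it.\<close>

lemma (in finsler_fibre) vertical_leaf_fibre:
  assumes LV: "is_leaf A vertical LV" and a: "fst ` LV \<subseteq> {a}"
  shows "open (fibre_coords c ` LV)" and "fibre_coords c ` LV \<subseteq> nonzero_fibre"
proof -
  have big: "u \<in> big_tangent0 A" "fst u = a" if "u \<in> LV" for u
    using leaf_subset_big_tangent0[OF LV] a that by auto
  then show "fibre_coords c ` LV \<subseteq> nonzero_fibre"
    using fibre_coords_nonzero by blast
  show "open (fibre_coords c ` LV)"
    unfolding open_contains_ball
  proof
    fix z
    assume "z \<in> fibre_coords c ` LV"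
    then obtain u where u: "u \<in> LV" "z = fibre_coords c u"
      by blast
    then have z: "lift z \<in> LV" "z \<in> nonzero_fibre"
      using lift_fibre_coords[OF big[OF u(1)]] fibre_coords_nonzero[OF big[OF u(1)]] by simp_all
    from z(2) obtain e where e: "e > 0" "ball z e \<subseteq> nonzero_fibre"
      using open_nonzero_fibre open_contains_ball by blast
    have "z' \<in> fibre_coords c ` LV" if z': "z' \<in> ball z e" for z'
    proof -
      define \<zeta> where "\<zeta> s = (1 - s) *\<^sub>R z + s *\<^sub>R z'" for s
      have "\<zeta> s \<in> nonzero_fibre" if "s \<in> {0..1}" for s
        using convexD_alt[OF convex_ball, of z z e z' s] z' e that by (auto simp: \<zeta>_def)
      moreover have "(\<zeta> has_vector_derivative z' - z) (at s within {0..1})" for s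
        unfolding \<zeta>_def[abs_def] by (auto intro!: derivative_eq_intros)
      ultimately have "tangent_curve A vertical (lift \<circ> \<zeta>)"
        by (intro tangent_curve_lift[of "\<lambda>_. z' - z"]) (auto simp: vertical_def)
      from leaf_closed_under_tangent_curves[OF LV this] have "lift z' \<in> LV"
        using z(1) by (simp add: \<zeta>_def)
      then show ?thesis
        using fibre_coords_lift by (metis imageI)
    qed
    with e(1) show "\<exists>e>0. ball z e \<subseteq> fibre_coords c ` LV"
      by blast
  qed
qed

section \<open>Second fundamental form and mean curvature\<close>

locale liouville_leaf = finsler_fibre T A F K c a
  for T :: "'m topology" and A :: "('m, 'n::finite) chart set" and F K c a +
  fixes LV L :: "('m, 'n) big_tangent set"
    and nabla :: "'n fibre_field \<Rightarrow> 'n fibre_field \<Rightarrow> 'n fibre_field"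
  assumes vertical_leaf: "is_leaf A vertical LV" and over_base: "fst ` LV = {a}"
    and liouville_leaf: "is_leaf A (vertical_liouville A F K) L" and sub_leaf: "L \<subseteq> LV"
    and metric_connection: "levi_civita (fibre_coords c ` LV) (vertical_metric A F K c a) nabla"
begin

abbreviation "\<Omega> \<equiv> fibre_coords c ` LV"
abbreviation "N \<equiv> fibre_coords c ` L"
abbreviation "G \<equiv> vertical_metric A F K c a"
abbreviation "\<rho> \<equiv> liouville_norm A F K c a"

sublocale hessian_connection nonzero_fibre \<Phi> \<Omega> nabla
proof
  show "open \<Omega>" "\<Omega> \<subseteq> nonzero_fibre"
    using vertical_leaf_fibre[OF vertical_leaf] over_base by auto
  then show "levi_civita \<Omega> (hess \<Phi>) nabla"
    using vertical_metric_hess by (intro levi_civita_cong[OF _ _ metric_connection]) auto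
qed

lemma leaf_point: "u \<in> L \<Longrightarrow> u \<in> big_tangent0 A \<and> fst u = a"
  using leaf_subset_big_tangent0[OF liouville_leaf] sub_leaf over_base by blast

lemma leaf_nonempty: "L \<noteq> {}"
  using liouville_leaf by (auto simp: is_leaf_def leaf_through_def)

lemma in_leaf_iff_lift: "z \<in> N \<longleftrightarrow> lift z \<in> L"
proof
  assume "z \<in> N"
  then obtain u where "u \<in> L" "z = fibre_coords c u"
    by blast
  with leaf_point show "lift z \<in> L"
    using lift_fibre_coords by metis
next
  assume "lift z \<in> L"
  then show "z \<in> N"
    using fibre_coords_lift by (metis imageI)
qed

lemma N_subset: "z \<in> N \<Longrightarrow> z \<in> \<Omega>" "z \<in> N \<Longrightarrow> z \<in> nonzero_fibre"
  using sub_leaf \<Omega>_subset by auto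

text \<open>The constant \<open>r\<close> is the common length of the Liouville field on the leaf, and by
  the last property the leaf lies in one level set of the potential.\<close>

lemma energy_on_leaf:
  obtains r where "r > 0" "\<And>b v p. (b, v, p) \<in> L \<Longrightarrow> (F b v)\<^sup>2 + (K b p)\<^sup>2 = r\<^sup>2"
    "\<And>z. z \<in> N \<Longrightarrow> 2 * \<Phi> z = r\<^sup>2"
proof -
  obtain s where "\<forall>(b, v, p)\<in>L. (F b v)\<^sup>2 + (K b p)\<^sup>2 = s"
    using energy_constant_on_leaf[OF manifold finsler cartan liouville_leaf] by blast
  then have s: "(F b v)\<^sup>2 + (K b p)\<^sup>2 = s" if "(b, v, p) \<in> L" for b v p
    using that by auto
  have \<Phi>s: "2 * \<Phi> z = s" if "z \<in> N" for z
  proof -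
    obtain b v p where u: "(b, v, p) \<in> L" "z = fibre_coords c (b, v, p)"
      using \<open>z \<in> N\<close> by auto
    then have "b = a" "(b, v, p) \<in> big_tangent0 A"
      using leaf_point by auto
    with u(2) s[OF u(1)] show ?thesis
      using energy_fibre_potential by simp
  qed
  moreover obtain z where "z \<in> N"
    using leaf_nonempty by blast
  ultimately have "s > 0"
    using potential_pos N_subset(2) by fastforce
  then show ?thesis
    using that[of "sqrt s"] s \<Phi>s by simp
qed

text \<open>Leaves are defined by curves on \<open>[0,1]\<close>, so the initial piece of
  \<open>\<zeta>\<close> up to \<open>s\<^sub>1\<close> is rescaled to that interval. Reaching
  every \<open>s\<^sub>1\<close>, and not just \<open>\<epsilon>\<close>, is what puts the entire
  curve into the leaf.\<close>

lemma leaf_contains_level_curves: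
  assumes z: "\<zeta> 0 \<in> N" and \<epsilon>: "s\<^sub>1 \<in> {0..\<epsilon>}" and cont: "continuous_on {0..\<epsilon>} \<zeta>'"
    and \<zeta>: "\<And>s. s \<in> {0..\<epsilon>} \<Longrightarrow> \<zeta> s \<in> nonzero_fibre \<and> d\<Phi> (\<zeta> s) (\<zeta>' s) = 0 \<and>
       (\<zeta> has_vector_derivative \<zeta>' s) (at s)"
  shows "\<zeta> s\<^sub>1 \<in> N"
proof -
  have s: "s\<^sub>1 * s \<in> {0..\<epsilon>}" if "s \<in> {0..1}" for s
    using \<epsilon> that mult_mono[of s\<^sub>1 \<epsilon> s 1] by auto
  have "tangent_curve A (vertical_liouville A F K) (lift \<circ> (\<lambda>s. \<zeta> (s\<^sub>1 * s)))"
  proof (rule tangent_curve_lift)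
    show "continuous_on {0..1} (\<lambda>s. s\<^sub>1 *\<^sub>R \<zeta>' (s\<^sub>1 * s))"
      using s by (intro continuous_intros continuous_on_compose2[OF cont]) auto
    fix s :: real
    assume "s \<in> {0..1}"
    note * = \<zeta>[OF s[OF this]]
    then show "\<zeta> (s\<^sub>1 * s) \<in> nonzero_fibre"
      by blast
    have "((\<lambda>s. s\<^sub>1 * s) has_vector_derivative s\<^sub>1) (at s within {0..1})"
      by (auto intro!: derivative_eq_intros simp flip: has_real_derivative_iff_has_vector_derivative)
    moreover have "(\<zeta> has_vector_derivative \<zeta>' (s\<^sub>1 * s)) (at (s\<^sub>1 * s) within (\<lambda>s. s\<^sub>1 * s) ` {0..1})"
      using * has_vector_derivative_at_within by blast
    ultimately show "((\<lambda>s. \<zeta> (s\<^sub>1 * s)) has_vector_derivative s\<^sub>1 *\<^sub>R \<zeta>' (s\<^sub>1 * s)) (at s within {0..1})"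
      using vector_diff_chain_within unfolding o_def by blast
    have "d\<Phi> (\<zeta> (s\<^sub>1 * s)) (s\<^sub>1 *\<^sub>R \<zeta>' (s\<^sub>1 * s)) = 0"
      using * linear_cmul[OF linear_d] by simp
    then show "(0, s\<^sub>1 *\<^sub>R \<zeta>' (s\<^sub>1 * s)) \<in> vertical_liouville A F K c (lift (\<zeta> (s\<^sub>1 * s)))"
      using * by (simp add: vertical_liouville_def fst_lift fibre_coords_lift liouville_orthogonal_iff)
  qed
  from leaf_closed_under_tangent_curves[OF liouville_leaf this] show ?thesis
    using z by (simp add: in_leaf_iff_lift)
qed

text \<open>The substitute for a submanifold structure on the leaf: a function that vanishes on the leaf
  also vanishes along a curve of \<open>level_curve\<close>, and its one-sided derivative at the
  start of that curve determines \<open>h' w\<close>.\<close>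

lemma derivative_along_leaf:
  fixes h' :: "'n fibre \<Rightarrow> real"
  assumes z: "z \<in> N" and w: "d\<Phi> z w = 0" and h: "(k has_derivative h') (at z)"
    and zero: "\<And>x. x \<in> N \<Longrightarrow> k x = 0"
  shows "h' w = 0"
proof -
  obtain \<epsilon> :: real and \<zeta> \<zeta>' where \<zeta>: "\<epsilon> > 0" "\<zeta> 0 = z" "\<zeta>' 0 = w" "continuous_on {0..\<epsilon>} \<zeta>'"
    "\<forall>s\<in>{0..\<epsilon>}. \<zeta> s \<in> nonzero_fibre \<and> d\<Phi> (\<zeta> s) (\<zeta>' s) = 0 \<and>
       (\<zeta> has_vector_derivative \<zeta>' s) (at s)"
    by (rule level_curve[OF N_subset(2)[OF z] w]) (rule that; assumption)
  have on_leaf: "\<zeta> s \<in> N" if "s \<in> {0..\<epsilon>}" for s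
    using z \<zeta>(2) by (intro leaf_contains_level_curves[OF _ that \<zeta>(4) bspec[OF \<zeta>(5)]]) simp_all
  have "(\<zeta> has_derivative (\<lambda>s. s *\<^sub>R w)) (at 0)"
    using bspec[OF \<zeta>(5), of 0] \<zeta>(1,3) by (simp add: has_vector_derivative_def)
  from has_derivative_compose[OF this] h \<zeta>(2)
  have "((\<lambda>s. k (\<zeta> s)) has_derivative (\<lambda>s. h' (s *\<^sub>R w))) (at 0)"
    by simp
  then have "((\<lambda>s. k (\<zeta> s)) has_vector_derivative h' w) (at 0)"
    using linear_cmul[OF has_derivative_linear[OF h]] by (simp add: has_vector_derivative_def)
  then have "((\<lambda>s. k (\<zeta> s)) has_vector_derivative h' w) (at 0 within {0..\<epsilon>})"
    by (rule has_vector_derivative_at_within)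
  then have "((\<lambda>s. 0) has_vector_derivative h' w) (at 0 within {0..\<epsilon>})"
    by (rule has_vector_derivative_transform[rotated 2]) (use \<zeta>(1) on_leaf zero in auto)
  moreover have "((\<lambda>s. 0::real) has_vector_derivative 0) (at 0 within {0..\<epsilon>})"
    by (rule has_vector_derivative_const)
  ultimately show ?thesis
    using \<zeta>(1) by (intro vector_derivative_unique_within_closed_interval[of 0 \<epsilon> 0]) auto
qed

lemma leaf_field_iff:
  "leaf_field \<Omega> N G X \<longleftrightarrow> smooth_on \<Omega> X \<and> (\<forall>u\<in>N. d\<Phi> u (X u) = 0)"
  using N_subset(2) by (auto simp: leaf_field_def liouville_orthogonal_iff)

text \<open>The function \<open>d\<Phi> w (Y w)\<close> of \<open>w\<close> vanishes on the leaf, so by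
  \<open>derivative_along_leaf\<close> the derivative term in \<open>metric_nabla_position\<close>
  is zero at points of the leaf.\<close>

lemma second_fundamental_form_leaf:
  assumes r: "r > 0" "\<And>z. z \<in> N \<Longrightarrow> 2 * \<Phi> z = r\<^sup>2"
    and X: "leaf_field \<Omega> N G X" and Y: "leaf_field \<Omega> N G Y" and u: "u \<in> N"
  shows "second_fundamental_form G \<rho> nabla X Y u = - (1 / r) * G u (X u) (Y u)"
proof -
  have X': "smooth_on \<Omega> X" "d\<Phi> u (X u) = 0" and Y': "smooth_on \<Omega> Y" "\<And>x. x \<in> N \<Longrightarrow> d\<Phi> x (Y x) = 0"
    using X Y u by (auto simp: leaf_field_iff)
  have "frechet_derivative (\<lambda>w. d\<Phi> w (Y w)) (at u) (X u) = 0"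
    using smooth_on_imp_has_derivative[OF smooth_on_d_field[OF open_\<Omega> \<Omega>_subset Y'(1)] N_subset(1)[OF u]]
    by (rule derivative_along_leaf[OF u X'(2)]) (rule Y'(2))
  then have "hess \<Phi> u (nabla X Y u) u = - hess \<Phi> u (Y u) (X u)"
    using metric_nabla_position[OF X'(1) Y'(1) N_subset(1)[OF u]] by simp
  then show ?thesis
    using r N_subset(2)[OF u] u metric_symmetric[OF N_subset(2)[OF u], of "Y u" "X u"]
    by (simp add: second_fundamental_form_def vertical_metric_hess liouville_norm_potential
        liouville_def case_prod_unfold)
qed

text \<open>The mean curvature is a definite description, so at least one frame has to exist. An orthonormal
  basis \<open>w i\<close> of the complement of \<open>u\<close> is extended by subtracting from
  the constant field its component along the position field. On the leaf the position field has
  squared length \<open>r\<^sup>2\<close>, so the division can be by this constant, and smoothness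
  on all of \<open>\<Omega>\<close> is immediate.\<close>

lemma orthonormal_leaf_fields_exist:
  assumes r: "r > 0" "\<And>z. z \<in> N \<Longrightarrow> 2 * \<Phi> z = r\<^sup>2" and u: "u \<in> N"
  shows "\<exists>e. orthonormal_leaf_fields \<Omega> N G u e"
proof -
  have uC: "u \<in> nonzero_fibre"
    using N_subset(2)[OF u] .
  have "DIM('n fibre) = 2 * CARD('n)"
    by simp
  then have "2 * CARD('n) - 1 < DIM('n fibre)"
    using zero_less_card_finite[where 'a = 'n] by arith
  from orthonormal_complement_of_position[OF uC this]
  obtain w where "\<forall>i\<in>{1..2 * CARD('n) - 1}. hess \<Phi> u (w i) u = 0 \<and>
      (\<forall>j\<in>{1..2 * CARD('n) - 1}. hess \<Phi> u (w i) (w j) = (if i = j then 1 else 0))"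
    by (elim exE)
  then have w: "\<And>i. i \<in> {1..2 * CARD('n) - 1} \<Longrightarrow> hess \<Phi> u (w i) u = 0"
    "\<And>i j. i \<in> {1..2 * CARD('n) - 1} \<Longrightarrow> j \<in> {1..2 * CARD('n) - 1} \<Longrightarrow>
      hess \<Phi> u (w i) (w j) = (if i = j then 1 else 0)"
    by blast+
  define e where "e i z = w i + (- d\<Phi> z (w i) / r\<^sup>2) *\<^sub>R z" for i z
  have "leaf_field \<Omega> N G (e i)" for i
    unfolding leaf_field_iff
  proof (intro conjI ballI)
    have d: "smooth_on \<Omega> (\<lambda>z. d\<Phi> z (w i))"
      by (intro smooth_on_frechet_derivative smooth_on_subset[OF smooth \<Omega>_subset])
    have "smooth_on \<Omega> (\<lambda>z. w i + (- 1 / r\<^sup>2) *\<^sub>R d\<Phi> z (w i) *\<^sub>R z)"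
      by (intro smooth_on_add smooth_on_scaleR smooth_on_const smooth_on_ident open_\<Omega> d)
    then show "smooth_on \<Omega> (e i)"
      by (simp add: e_def[abs_def])
    fix z
    assume z: "z \<in> N"
    have zC: "z \<in> nonzero_fibre"
      using N_subset(2)[OF z] .
    show "d\<Phi> z (e i z) = 0"
      unfolding e_def linear_add[OF linear_d[OF zC]] linear_cmul[OF linear_d[OF zC]] euler_potential[OF zC]
      using r(1) r(2)[OF z] by simp
  qed
  moreover have "e i u = w i" if "i \<in> {1..2 * CARD('n) - 1}" for i
    using w(1)[OF that] metric_position_right[OF uC] by (simp add: e_def)
  ultimately show ?thesis
    unfolding orthonormal_leaf_fields_def
    using w(2) vertical_metric_hess[OF uC] by (intro exI[of _ e]) auto
qed

text \<open>By \<open>second_fundamental_form_leaf\<close> every diagonal entry \<open>B(e\<^sub>i,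
  e\<^sub>i)\<close> is \<open>- 1/r\<close>, so all frames give the same average, as the definite
  description requires.\<close>

lemma mean_curvature_leaf:
  assumes r: "r > 0" "\<And>z. z \<in> N \<Longrightarrow> 2 * \<Phi> z = r\<^sup>2" and u: "u \<in> N"
  shows "mean_curvature \<Omega> N G \<rho> nabla u = - (1 / r)"
proof -
  have avg: "(1 / (2 * real CARD('n) - 1)) *
      (\<Sum>i = 1..2 * CARD('n) - 1. second_fundamental_form G \<rho> nabla (e i) (e i) u) = - (1 / r)"
    if e: "orthonormal_leaf_fields \<Omega> N G u e" for e
  proof -
    have "second_fundamental_form G \<rho> nabla (e i) (e i) u = - (1 / r)"
      if "i \<in> {1..2 * CARD('n) - 1}" for i
      using e that second_fundamental_form_leaf[OF r _ _ u, of "e i" "e i"]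
      by (simp add: orthonormal_leaf_fields_def)
    then have "(\<Sum>i = 1..2 * CARD('n) - 1. second_fundamental_form G \<rho> nabla (e i) (e i) u)
        = real (2 * CARD('n) - 1) * - (1 / r)"
      by simp
    moreover have "1 \<le> CARD('n)"
      using zero_less_card_finite[where 'a = 'n] by arith
    then have "real (2 * CARD('n) - 1) = 2 * real CARD('n) - 1" "2 * real CARD('n) - 1 \<noteq> 0"
      by linarith+
    ultimately show ?thesis
      by simp
  qed
  obtain e where "orthonormal_leaf_fields \<Omega> N G u e"
    using orthonormal_leaf_fields_exist[OF r u] by blast
  then show ?thesis
    unfolding mean_curvature_def by (intro the_equality) (use avg in auto)
qed

end

theorem theorem2p2:
  fixes T :: "'m topology" and A :: "('m, 'n::finite) chart set"
    and F K :: "'m \<Rightarrow> ('m, 'n) components \<Rightarrow> real"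
    and LV L :: "('m, 'n) big_tangent set"
    and a :: 'm and c :: "('m, 'n) chart"
    and nabla :: "'n fibre_field \<Rightarrow> 'n fibre_field \<Rightarrow> 'n fibre_field"
    and \<gamma> :: "real \<Rightarrow> ('m, 'n) big_tangent" and I :: "real set"
  defines "G \<equiv> vertical_metric A F K c a"
    and "\<rho> \<equiv> liouville_norm A F K c a"
    and "\<Omega> \<equiv> fibre_coords c ` LV"
    and "N \<equiv> fibre_coords c ` L"
  assumes "smooth_manifold T A"
    and "finsler_structure A F"
    and "dual_cartan_structure A F K"
    and "is_leaf A vertical LV" and "fst ` LV = {a}"
    and "is_leaf A (vertical_liouville A F K) L" and "L \<subseteq> LV"
    and "c \<in> A" and "a \<in> cdom c"
    and "levi_civita \<Omega> G nabla"
    and "open I" and "is_interval I" and "\<gamma> ` I \<subseteq> LV"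
    and "\<And>t. t \<in> I \<Longrightarrow> ((fibre_coords c \<circ> \<gamma>) has_vector_derivative
             (1 / \<rho> (fibre_coords c (\<gamma> t))) *\<^sub>R liouville (fibre_coords c (\<gamma> t))) (at t)"
  shows "is_geodesic nabla I (fibre_coords c \<circ> \<gamma>) \<and>
         totally_umbilical \<Omega> N G \<rho> nabla \<and>
         (\<exists>r>0. (\<forall>(b, v, p)\<in>L. (F b v)\<^sup>2 + (K b p)\<^sup>2 = r\<^sup>2) \<and>
                (\<forall>u\<in>N. mean_curvature \<Omega> N G \<rho> nabla u = - (1 / r))) \<and>
         (L \<inter> generalized_indicatrix A F K a \<noteq> {} \<longrightarrow>
            L \<subseteq> generalized_indicatrix A F K a \<and>
            (\<forall>u\<in>N. mean_curvature \<Omega> N G \<rho> nabla u = - 1))"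
proof -
  interpret liouville_leaf T A F K c a LV L nabla
    using assms by unfold_locales (auto simp: dual_cartan_structure_def)
  obtain r where r: "r > 0" "\<And>b v p. (b, v, p) \<in> L \<Longrightarrow> (F b v)\<^sup>2 + (K b p)\<^sup>2 = r\<^sup>2"
    "\<And>z. z \<in> fibre_coords c ` L \<Longrightarrow> 2 * fibre_potential A F K c a z = r\<^sup>2"
    by (rule energy_on_leaf) blast
  have "is_geodesic nabla I (fibre_coords c \<circ> \<gamma>)"
  proof (rule radial_geodesic[OF \<open>open I\<close>])
    show "(fibre_coords c \<circ> \<gamma>) t \<in> fibre_coords c ` LV" if "t \<in> I" for t
      using \<open>\<gamma> ` I \<subseteq> LV\<close> that by auto
    show "((fibre_coords c \<circ> \<gamma>) has_vector_derivative
        (1 / sqrt (2 * fibre_potential A F K c a ((fibre_coords c \<circ> \<gamma>) t))) *\<^sub>R (fibre_coords c \<circ> \<gamma>) t) (at t)"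
      if "t \<in> I" for t
      using assms(18)[OF that]
      by (simp add: \<rho>_def liouville_norm_potential liouville_def case_prod_unfold)
  qed
  moreover have "totally_umbilical \<Omega> N G \<rho> nabla"
    unfolding totally_umbilical_def \<Omega>_def N_def G_def \<rho>_def
    using second_fundamental_form_leaf[OF r(1,3)] by (intro exI[of _ "\<lambda>_. - (1 / r)"]) blast
  moreover have curvature: "mean_curvature \<Omega> N G \<rho> nabla u = - (1 / r)" if "u \<in> N" for u
    using mean_curvature_leaf[OF r(1,3)] that unfolding \<Omega>_def N_def G_def \<rho>_def by blast
  moreover have "r = 1" if meets: "L \<inter> generalized_indicatrix A F K a \<noteq> {}"
  proof -
    obtain w where "w \<in> L" "w \<in> generalized_indicatrix A F K a"
      using meets by blast
    moreover obtain b v p where "w = (b, v, p)"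
      by (rule prod_cases3)
    ultimately have "r\<^sup>2 = 1"
      using r(2) by (auto simp: generalized_indicatrix_def)
    with r(1) show ?thesis
      by (simp add: power2_eq_1_iff)
  qed
  moreover have "L \<subseteq> generalized_indicatrix A F K a" if "r = 1"
    using leaf_point r(2) that by (force simp: generalized_indicatrix_def)
  ultimately show ?thesis
    using r(1,2) by auto
qed

end
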